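(* The Laplace transforms $L_{W}^{\pm}(a,\lambda)=\int_{0}^{\infty} e^{-\lambda t} W(a,\pm t)dt$ are expressible in terms of the general Nield-Kuznetsov functions $W_R^{(0,3)}$ via \[ L_{W}^{\pm}(a,\lambda) =\pm W'(a,0) W_{0}^{(0,3)}(a,2\lambda)+\tfrac{1}{2}W(a,0) W_{1}^{(0,3)}(a,2\lambda). \]
   Context: $a$ is real; $W(a,\pm t)$ are the Weber parabolic cylinder functions (DLMF Sect. 12.14), solutions of $y''+(\tfrac14 t^2-a)y=0$. $L_{W}^{\pm}(a,\lambda)=\int_{0}^{\infty} e^{-\lambda t} W(a,\pm t)dt$ for $|\arg\lambda|\le\tfrac12\pi$, and by analytic continuation elsewhere (entire in $\lambda$). $U(a,z)$ is the standard parabolic cylinder function; $W_{j}(a,z)=U\left((-1)^{j}ia,(-i)^{j}ze^{-\pi i/4}\right)$ for $j=0,3$. For $R=0,1,\dots$, $W_{R}^{(0,3)}(a,z)=ie^{\pi a/2}[W_{3}(a,z)\int_{e^{\pi i/4}\infty}^z t^{R}W_{0}(a,t)dt-W_{0}(a,z)\int_{e^{-\pi i/4}\infty}^z t^{R}W_{3}(a,t)dt]$, which solves $y''+(\tfrac14 z^2-a)y=z^R$ and is $\mathcal O(z^{R-2})$ as $z\to\infty$ in $|\arg z|\le\tfrac12\pi-\delta$. *)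

theory Defs
  imports "HOL-Complex_Analysis.Complex_Analysis"
begin

text \<open>Standard parabolic cylinder function U(a,z) (DLMF 12.2): the entire solution of
  y'' = (z^2/4 + a) y with the initial values of DLMF 12.2.6--12.2.7.\<close>

definition U0 :: "complex \<Rightarrow> complex" where
  "U0 a = complex_of_real (sqrt pi) * (2 powr (-(a/2 + 1/4))) * rGamma (3/4 + a/2)"

definition U0' :: "complex \<Rightarrow> complex" where
  "U0' a = - complex_of_real (sqrt pi) * (2 powr (-(a/2 - 1/4))) * rGamma (1/4 + a/2)"

definition U :: "complex \<Rightarrow> complex \<Rightarrow> complex" where
  "U a = (THE f. \<exists>f'. (\<forall>z. (f has_field_derivative f' z) (at z) \<and>
                         (f' has_field_derivative ((z^2/4 + a) * f z)) (at z))
                    \<and> f 0 = U0 a \<and> f' 0 = U0' a)"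

text \<open>Weber parabolic cylinder function W(a,x), x real (DLMF 12.14): the real solution
  of y'' + (x^2/4 - a) y = 0 with the initial values of DLMF 12.14.5--12.14.6.\<close>

definition W0 :: "real \<Rightarrow> real" where
  "W0 a = 2 powr (-3/4) *
     sqrt (norm (Gamma (1/4 + \<i> * complex_of_real a / 2) / Gamma (3/4 + \<i> * complex_of_real a / 2)))"

definition W0' :: "real \<Rightarrow> real" where
  "W0' a = - (2 powr (-1/4)) *
     sqrt (norm (Gamma (3/4 + \<i> * complex_of_real a / 2) / Gamma (1/4 + \<i> * complex_of_real a / 2)))"

definition W :: "real \<Rightarrow> real \<Rightarrow> real" where
  "W a = (THE f. \<exists>f'. (\<forall>x. (f has_real_derivative f' x) (at x) \<and>
                         (f' has_real_derivative ((a - x^2/4) * f x)) (at x))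
                    \<and> f 0 = W0 a \<and> f' 0 = W0' a)"

definition LW :: "real \<Rightarrow> real \<Rightarrow> complex \<Rightarrow> complex" where
  "LW s a = (THE F. F holomorphic_on UNIV \<and>
     (\<forall>lam. Re lam > 0 \<longrightarrow>
        ((\<lambda>t::real. exp (- lam * complex_of_real t) * complex_of_real (W a (s * t)))
           has_integral F lam) {0..}))"

definition Wj :: "nat \<Rightarrow> real \<Rightarrow> complex \<Rightarrow> complex" where
  "Wj j a z = U ((-1)^j * \<i> * complex_of_real a) ((-\<i>)^j * z * exp (- \<i> * pi / 4))"

text \<open>Integral from d\<infinity> (d a unit direction) to z of an entire function f:
  the integral from d\<infinity> to 0 along the ray followed by the segment [0,z].\<close>

definition int_from_inf :: "complex \<Rightarrow> (complex \<Rightarrow> complex) \<Rightarrow> complex \<Rightarrow> complex" where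
  "int_from_inf d f z =
     contour_integral (linepath 0 z) f - d * integral {0::real..} (\<lambda>r. f (complex_of_real r * d))"

definition NK :: "nat \<Rightarrow> real \<Rightarrow> complex \<Rightarrow> complex" where
  "NK R a z = \<i> * exp (complex_of_real (pi * a / 2)) *
     (Wj 3 a z * int_from_inf (exp (\<i> * pi / 4)) (\<lambda>t. t ^ R * Wj 0 a t) z
      - Wj 0 a z * int_from_inf (exp (- \<i> * pi / 4)) (\<lambda>t. t ^ R * Wj 3 a t) z)"

end

theory Submission
  imports Defs "HOL-Real_Asymp.Real_Asymp"
begin

text \<open>The Laplace transform turns Weber's equation into \<open>L'' + 4 (\<lambda>\<^sup>2 - a) L = 4 (\<lambda> w(0) + w'(0))\<close>, so
  \<open>y(z) = L(z/2)\<close> solves \<open>y'' + (z\<^sup>2/4 - a) y = w'(0) + z w(0)/2\<close> in the right half-plane.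
  Green's identity against each of \<open>W\<^sub>0\<close> and \<open>W\<^sub>3\<close>, taken from infinity along the ray on which that
  solution decays and \<open>y\<close>, \<open>y'\<close> stay bounded, expresses the Wronskians of \<open>y\<close> with \<open>W\<^sub>0\<close> and \<open>W\<^sub>3\<close> by the
  integrals in the Nield-Kuznetsov functions. Eliminating \<open>y'\<close> with the explicit Wronskian of \<open>W\<^sub>0\<close>, \<open>W\<^sub>3\<close>
  gives the formula, and the identity theorem extends it. The decay of \<open>U\<close> comes from
  \<open>U(\<alpha>,z) = e\<^bsup>-z\<^sup>2/4\<^esup> / \<Gamma>(\<alpha>+1/2) \<integral> t\<^bsup>\<alpha>-1/2\<^esup> e\<^bsup>-t\<^sup>2/2-zt\<^esup> dt\<close> over \<open>t > 0\<close>, and \<open>W(a,\<plusminus>x)\<close> is bounded for \<open>x \<ge> 0\<close> because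
  \<open>W\<^sub>0\<close> and \<open>W\<^sub>3\<close> are.\<close>

section \<open>Laplace transforms on a half-plane\<close>

lemma absolutely_integrable_bounded_continuous_mult:
  fixes f g :: "real \<Rightarrow> complex"
  assumes "continuous_on {0..} f" and "\<And>t. t \<ge> 0 \<Longrightarrow> norm (f t) \<le> B"
    and "g absolutely_integrable_on {0..}"
  shows "(\<lambda>t. f t * g t) absolutely_integrable_on {0..}"
proof (rule absolutely_integrable_bounded_measurable_product[where h = "(*)", OF _ _ _ _ assms(3)])
  show "bilinear ((*) :: complex \<Rightarrow> complex \<Rightarrow> complex)"
    by (simp add: bilinear_conv_bounded_bilinear bounded_bilinear_mult)
  show "f \<in> borel_measurable (lebesgue_on {0..})"
    by (intro continuous_imp_measurable_on_sets_lebesgue assms(1)) auto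
  show "bounded (f ` {0..})"
    using assms(2) by (auto simp: bounded_iff)
qed auto

text \<open>Differentiability is asked only at \<open>t > 0\<close>, because the primitive used for
  the recurrence of the kernel contains a power of \<open>t\<close> that may fail to be
  differentiable at 0. When \<open>F\<close> tends to 0, this evaluates the integral as
  \<open>- F 0\<close>.\<close>

lemma tendsto_primitive_at_top:
  fixes F f :: "real \<Rightarrow> complex"
  assumes "f absolutely_integrable_on {0..}" and "continuous_on {0..} F"
    and "\<And>t. t > 0 \<Longrightarrow> (F has_vector_derivative f t) (at t)"
  shows "(F \<longlongrightarrow> F 0 + integral {0..} f) at_top"
proof -
  have "((\<lambda>b. LINT t:{0..b}|lebesgue. f t) \<longlongrightarrow> (LINT t:{0..}|lebesgue. f t)) at_top"
    by (rule tendsto_set_lebesgue_integral_at_top) (use assms in auto)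
  then have lim: "((\<lambda>b. F 0 + (LINT t:{0..b}|lebesgue. f t)) \<longlongrightarrow> F 0 + integral {0..} f) at_top"
    using assms(1) by (intro tendsto_intros) (simp add: set_lebesgue_integral_eq_integral)
  have "F 0 + (LINT t:{0..b}|lebesgue. f t) = F b" if b: "b \<ge> 0" for b
  proof -
    have "f absolutely_integrable_on {0..b}"
      by (rule set_integrable_subset[OF assms(1)]) auto
    then have "(LINT t:{0..b}|lebesgue. f t) = integral {0..b} f"
      by (simp add: set_lebesgue_integral_eq_integral)
    moreover have "(f has_integral (F b - F 0)) {0..b}"
      by (rule fundamental_theorem_of_calculus_interior)
         (use assms b in \<open>auto intro: continuous_on_subset\<close>)
    ultimately show ?thesis by (simp add: integral_unique)
  qed
  then show ?thesis
    by (intro Lim_transform_eventually[OF lim]) (auto simp: eventually_at_top_linorder)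
qed

text \<open>Quantifying over the open half-plane leaves room to move the abscissa: a factor of
  \<open>t\<close>, or a small exponential, is absorbed by passing to a smaller real part.\<close>

definition laplace_integrable :: "real \<Rightarrow> (real \<Rightarrow> complex) \<Rightarrow> bool" where
  "laplace_integrable \<sigma> \<phi> \<longleftrightarrow>
     (\<forall>z. Re z > \<sigma> \<longrightarrow> (\<lambda>t. exp (- z * of_real t) * \<phi> t) absolutely_integrable_on {0..})"

definition laplace :: "(real \<Rightarrow> complex) \<Rightarrow> complex \<Rightarrow> complex" where
  "laplace \<phi> z = integral {0..} (\<lambda>t. exp (- z * of_real t) * \<phi> t)"

lemma laplace_integrableD:
  "laplace_integrable \<sigma> \<phi> \<Longrightarrow> Re z > \<sigma> \<Longrightarrow>
     (\<lambda>t. exp (- z * of_real t) * \<phi> t) absolutely_integrable_on {0..}"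
  by (simp add: laplace_integrable_def)

lemma mult_exp_neg_le:
  fixes c t :: real
  assumes "c > 0" "t \<ge> 0"
  shows "t * exp (- c * t) \<le> 1 / c"
proof -
  have "c * t \<le> exp (c * t)" using exp_ge_add_one_self[of "c * t"] by linarith
  then show ?thesis using assms by (simp add: exp_minus field_simps)
qed

text \<open>Half of the gap between \<open>Re z\<close> and \<open>\<sigma>\<close> is spent on
  making \<open>t * exp (- \<epsilon> * t)\<close> bounded. The factor \<open>- t\<close> is the
  derivative of the exponent in \<open>z\<close>, so iterating the lemma reaches all derivatives of
  the transform.\<close>

lemma laplace_integrable_mult_ident:
  assumes "laplace_integrable \<sigma> \<phi>"
  shows "laplace_integrable \<sigma> (\<lambda>t. - of_real t * \<phi> t)"
  unfolding laplace_integrable_def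
proof (intro allI impI)
  fix z assume z: "Re z > \<sigma>"
  define \<epsilon> where "\<epsilon> = (Re z - \<sigma>) / 2"
  have e: "\<epsilon> > 0" "Re (z - of_real \<epsilon>) > \<sigma>" using z by (auto simp: \<epsilon>_def field_simps)
  have "(\<lambda>t. (- of_real t * exp (- of_real \<epsilon> * of_real t)) * (exp (- (z - of_real \<epsilon>) * of_real t) * \<phi> t))
      absolutely_integrable_on {0..}"
  proof (rule absolutely_integrable_bounded_continuous_mult)
    show "norm (- of_real t * exp (- of_real \<epsilon> * of_real t) :: complex) \<le> 1 / \<epsilon>" if "t \<ge> 0" for t
      using mult_exp_neg_le[OF e(1) that] that by (simp add: norm_mult)
  qed (use laplace_integrableD[OF assms e(2)] in \<open>auto intro!: continuous_intros\<close>)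
  moreover have "(- of_real t * exp (- of_real \<epsilon> * of_real t)) * (exp (- (z - of_real \<epsilon>) * of_real t) * \<phi> t)
      = exp (- z * of_real t) * (- of_real t * \<phi> t)" for t
    by (simp add: ring_distribs exp_diff exp_minus divide_simps)
  ultimately show "(\<lambda>t. exp (- z * of_real t) * (- of_real t * \<phi> t)) absolutely_integrable_on {0..}"
    by (simp only:)
qed

lemma norm_exp_minus_linear_le: "norm (exp z - 1 - z) \<le> norm z ^ 2 * exp (norm z)" for z :: complex
proof -
  have "norm (exp z - (\<Sum>k\<le>1. z ^ k / fact k)) \<le> exp (norm z) * norm z ^ Suc 1 / fact 1"
    by (rule Taylor_exp_field)
  then show ?thesis by (simp add: power2_eq_square algebra_simps)
qed

text \<open>Differentiation under the integral sign with an explicit error: the difference quotient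
  deviates from the claimed derivative by at most \<open>norm h * K\<close>.\<close>

lemma has_field_derivative_laplace:
  assumes "laplace_integrable \<sigma> \<phi>" and "Re z > \<sigma>"
  shows "(laplace \<phi> has_field_derivative laplace (\<lambda>t. - of_real t * \<phi> t) z) (at z)"
proof -
  define \<epsilon> where "\<epsilon> = (Re z - \<sigma>) / 2"
  \<comment> \<open>The abscissa \<open>x\<close> lies \<open>\<epsilon>\<close> to the left of
    \<open>Re z\<close>, which pays for the growth \<open>exp (norm h * t)\<close> of the Taylor
    remainder; the quadratic order of that remainder accounts for the two factors \<open>t\<close>
    in \<open>g\<close>.\<close>
  define x where "x = Re z - \<epsilon>"
  have e: "\<epsilon> > 0" "x > \<sigma>" "x = Re z - \<epsilon>" using assms(2) by (auto simp: \<epsilon>_def x_def field_simps)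
  define g where "g = (\<lambda>t. exp (- of_real x * of_real t) * (- of_real t * (- of_real t * \<phi> t)) :: complex)"
  have g: "g absolutely_integrable_on {0..}" unfolding g_def
    by (rule laplace_integrableD[of \<sigma>, OF laplace_integrable_mult_ident[OF laplace_integrable_mult_ident]])
       (use e assms in auto)
  define K where "K = integral {0..} (\<lambda>t. norm (g t))"
  define D where "D = laplace (\<lambda>t. - of_real t * \<phi> t) z"
  have K: "K \<ge> 0" unfolding K_def by (intro integral_nonneg) (use g in \<open>auto simp: absolutely_integrable_on_def\<close>)
  have bound: "norm ((laplace \<phi> (z + h) - laplace \<phi> z) / h - D) \<le> norm h * K"
    if h: "h \<noteq> 0" "norm h < \<epsilon>" for h
  proof -
    have "Re (z + h) > \<sigma>" using h e abs_Re_le_cmod[of h] by simp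
    note i1 = laplace_integrableD[OF assms(1) this] and i2 = laplace_integrableD[OF assms]
      and i3 = laplace_integrableD[OF laplace_integrable_mult_ident[OF assms(1)] assms(2)]
    note ii = i1[THEN set_lebesgue_integral_eq_integral(1)] i2[THEN set_lebesgue_integral_eq_integral(1)]
       i3[THEN set_lebesgue_integral_eq_integral(1)]
    let ?r = "\<lambda>t. exp (- (z + h) * of_real t) * \<phi> t - exp (- z * of_real t) * \<phi> t
             - h * (exp (- z * of_real t) * (- of_real t * \<phi> t))"
    have r: "(?r has_integral (laplace \<phi> (z + h) - laplace \<phi> z - h * D)) {0..}"
      unfolding laplace_def D_def
      by (intro has_integral_diff has_integral_mult_right integrable_integral ii)
    have "norm (laplace \<phi> (z + h) - laplace \<phi> z - h * D) = norm (integral {0..} ?r)"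
      using r by (simp add: integral_unique)
    also have "\<dots> \<le> integral {0..} (\<lambda>t. norm h ^ 2 * norm (g t))"
    proof (rule integral_norm_bound_integral)
      show "?r integrable_on {0..}" using r by blast
      show "(\<lambda>t. norm h ^ 2 * norm (g t)) integrable_on {0..}"
        using g by (intro integrable_on_mult_right) (auto simp: absolutely_integrable_on_def)
      fix t :: real assume "t \<in> {0..}"
      then have t: "t \<ge> 0" by simp
      have "?r t = exp (- z * of_real t) * (exp (- h * of_real t) - 1 - (- h * of_real t)) * \<phi> t"
        by (simp add: algebra_simps exp_add exp_diff exp_minus divide_simps)
      then have "norm (?r t) = exp (- Re z * t) * norm (exp (- h * of_real t) - 1 - (- h * of_real t)) * norm (\<phi> t)"
        by (simp add: norm_mult)
      also have "\<dots> \<le> exp (- Re z * t) * ((norm h * t) ^ 2 * exp (norm h * t)) * norm (\<phi> t)"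
        using norm_exp_minus_linear_le[of "- h * of_real t"] t
        by (intro mult_right_mono mult_left_mono) (auto simp: norm_mult)
      also have "\<dots> \<le> exp (- Re z * t) * ((norm h * t) ^ 2 * exp (\<epsilon> * t)) * norm (\<phi> t)"
        using h t by (intro mult_right_mono mult_left_mono) (auto intro: mult_right_mono)
      also have "\<dots> = norm h ^ 2 * (exp (- x * t) * (t * (t * norm (\<phi> t))))"
      proof -
        have "exp (- Re z * t) * exp (\<epsilon> * t) = exp (- x * t)"
          by (simp add: e(3) algebra_simps flip: exp_add)
        then show ?thesis by (simp add: power2_eq_square)
      qed
      also have "\<dots> = norm h ^ 2 * norm (g t)"
        using t by (simp add: g_def norm_mult)
      finally show "norm (?r t) \<le> norm h ^ 2 * norm (g t)" .
    qed
    also have "\<dots> = norm h ^ 2 * K" by (simp add: K_def)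
    finally have "norm (laplace \<phi> (z + h) - laplace \<phi> z - h * D) \<le> norm h ^ 2 * K" .
    moreover have "(laplace \<phi> (z + h) - laplace \<phi> z) / h - D = (laplace \<phi> (z + h) - laplace \<phi> z - h * D) / h"
      using h by (simp add: field_simps)
    ultimately show ?thesis using h
      by (simp add: norm_divide divide_simps power2_eq_square mult.commute mult.left_commute)
  qed
  have "((\<lambda>h. (laplace \<phi> (z + h) - laplace \<phi> z) / h - D) \<longlongrightarrow> 0) (at 0)"
  proof (rule Lim_null_comparison)
    show "\<forall>\<^sub>F h in at 0. norm ((laplace \<phi> (z + h) - laplace \<phi> z) / h - D) \<le> norm h * K"
      using bound e(1) by (auto simp: eventually_at)
    show "((\<lambda>h. norm h * K) \<longlongrightarrow> 0) (at (0::complex))"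
      by (auto intro!: tendsto_eq_intros)
  qed
  then show ?thesis unfolding DERIV_def D_def[symmetric] by (simp add: LIM_zero_iff)
qed

text \<open>It controls transforms uniformly on closed half-planes, and so along rays that stay
  inside one.\<close>

lemma norm_laplace_le:
  assumes "laplace_integrable \<sigma> \<phi>" and "x > \<sigma>" "Re z \<ge> x"
  shows "norm (laplace \<phi> z) \<le> integral {0..} (\<lambda>t. norm (exp (- of_real x * of_real t) * \<phi> t))"
  unfolding laplace_def
proof (rule integral_norm_bound_integral)
  have x: "Re (of_real x) > \<sigma>" "Re z > \<sigma>" using assms by auto
  show "(\<lambda>t. exp (- z * of_real t) * \<phi> t) integrable_on {0..}"
    using laplace_integrableD[OF assms(1) x(2)] by (simp add: absolutely_integrable_on_def)
  show "(\<lambda>t. norm (exp (- of_real x * of_real t) * \<phi> t)) integrable_on {0..}"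
    using laplace_integrableD[OF assms(1) x(1)] by (simp add: absolutely_integrable_on_def)
qed (use assms in \<open>auto simp: norm_mult intro!: mult_mono mult_right_mono\<close>)

section \<open>The integral representation of the parabolic cylinder function\<close>

lemma wronskian_const:
  fixes Q p p' q q' :: "'a::real_normed_field \<Rightarrow> 'a"
  assumes "\<And>x. (p has_field_derivative p' x) (at x)" "\<And>x. (p' has_field_derivative Q x * p x) (at x)"
    and "\<And>x. (q has_field_derivative q' x) (at x)" "\<And>x. (q' has_field_derivative Q x * q x) (at x)"
  shows "p x * q' x - p' x * q x = p 0 * q' 0 - p' 0 * q 0"
proof -
  have "\<exists>c. \<forall>x\<in>UNIV. p x * q' x - p' x * q x = c"
    by (rule has_field_derivative_zero_constant)
       (auto intro!: derivative_eq_intros assms simp: algebra_simps)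
  then show ?thesis by auto
qed

text \<open>A solution with vanishing initial data has zero Wronskian with each of two independent solutions.\<close>

lemma linear_ode_unique_zero:
  fixes Q y y' p p' q q' :: "'a::real_normed_field \<Rightarrow> 'a"
  assumes y: "\<And>x. (y has_field_derivative y' x) (at x)" "\<And>x. (y' has_field_derivative Q x * y x) (at x)"
    and p: "\<And>x. (p has_field_derivative p' x) (at x)" "\<And>x. (p' has_field_derivative Q x * p x) (at x)"
    and q: "\<And>x. (q has_field_derivative q' x) (at x)" "\<And>x. (q' has_field_derivative Q x * q x) (at x)"
    and init: "y 0 = 0" "y' 0 = 0" and wr: "p 0 * q' 0 - p' 0 * q 0 \<noteq> 0"
  shows "y x = 0"
proof -
  have 1: "y x * p' x = y' x * p x" and 2: "y x * q' x = y' x * q x"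
    using wronskian_const[OF y p, of x] wronskian_const[OF y q, of x] init by auto
  have "y x * (p x * q' x - p' x * q x) = p x * (y x * q' x) - (y x * p' x) * q x"
    by (simp add: algebra_simps)
  also have "\<dots> = 0" by (simp add: 1 2)
  finally show ?thesis using wr wronskian_const[OF p q, of x] by simp
qed

text \<open>The independent solutions \<open>p\<close> and \<open>q\<close> are supplied explicitly,
  so uniqueness is reduced to algebra with Wronskians. The field is left general because the lemma
  serves \<open>U\<close> on the complex plane and \<open>W\<close> on the real line.\<close>

lemma linear_ode_unique:
  fixes Q y y' w w' p p' q q' :: "'a::real_normed_field \<Rightarrow> 'a"
  assumes y: "\<And>x. (y has_field_derivative y' x) (at x)" "\<And>x. (y' has_field_derivative Q x * y x) (at x)"
    and w: "\<And>x. (w has_field_derivative w' x) (at x)" "\<And>x. (w' has_field_derivative Q x * w x) (at x)"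
    and p: "\<And>x. (p has_field_derivative p' x) (at x)" "\<And>x. (p' has_field_derivative Q x * p x) (at x)"
    and q: "\<And>x. (q has_field_derivative q' x) (at x)" "\<And>x. (q' has_field_derivative Q x * q x) (at x)"
    and "y 0 = w 0" "y' 0 = w' 0" and "p 0 * q' 0 - p' 0 * q 0 \<noteq> 0"
  shows "y = w"
proof
  fix x
  have "y x - w x = 0"
    by (rule linear_ode_unique_zero[where Q = Q and y' = "\<lambda>x. y' x - w' x" and p = p and p' = p' and q = q and q' = q'])
       (use assms in \<open>auto intro!: derivative_eq_intros simp: algebra_simps\<close>)
  then show "y x = w x" by simp
qed

section \<open>The kernel of the integral representation and its Laplace transform\<close>

definition pcf_kernel :: "complex \<Rightarrow> real \<Rightarrow> complex" where
  "pcf_kernel \<alpha> t = of_real t powr (\<alpha> - 1/2) * of_real (exp (- t\<^sup>2 / 2))"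

text \<open>Differentiating the transform thus shifts the parameter by 1. At \<open>t = 0\<close>
  both sides are 0, since \<open>0 powr w = 0\<close> for every \<open>w\<close>.\<close>

lemma pcf_kernel_Suc: "t \<ge> 0 \<Longrightarrow> of_real t * pcf_kernel \<alpha> t = pcf_kernel (\<alpha> + 1) t"
  using powr_add[of "of_real t" 1 "\<alpha> - 1/2"] by (simp add: pcf_kernel_def add.commute)

text \<open>Comparison with the Gamma integrand at \<open>\<alpha> + 1/2\<close>, whose real part is
  positive; the remaining factor is bounded thanks to the Gaussian. Nothing restricts
  \<open>Re z\<close>, hence \<open>\<sigma>\<close> is arbitrary.\<close>

lemma laplace_integrable_pcf_kernel:
  assumes "Re \<alpha> > -1/2"
  shows "laplace_integrable \<sigma> (pcf_kernel \<alpha>)"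
  unfolding laplace_integrable_def
proof (intro allI impI)
  fix z :: complex
  have "(\<lambda>t. complex_of_real t powr (\<alpha> + 1/2 - 1) / of_real (exp (1 * t))) absolutely_integrable_on {0<..}"
    by (rule absolutely_integrable_Gamma_integral) (use assms in auto)
  also have "?this \<longleftrightarrow> (\<lambda>t. complex_of_real t powr (\<alpha> - 1/2) / of_real (exp t)) absolutely_integrable_on {0..}"
    unfolding set_integrable_def by (intro Bochner_Integration.integrable_cong) (auto simp: indicator_def)
  finally have g: "(\<lambda>t. complex_of_real t powr (\<alpha> - 1/2) / of_real (exp t)) absolutely_integrable_on {0..}" .
  have "(\<lambda>t. exp (of_real t - z * of_real t - of_real (t\<^sup>2 / 2)) * (complex_of_real t powr (\<alpha> - 1/2) / of_real (exp t)))
      absolutely_integrable_on {0..}"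
  proof (rule absolutely_integrable_bounded_continuous_mult[OF _ _ g])
    show "norm (exp (of_real t - z * of_real t - of_real (t\<^sup>2 / 2))) \<le> exp ((1 - Re z)\<^sup>2 / 2)" for t
    proof -
      \<comment> \<open>Completing the square: the left side is largest at
        \<open>t = 1 - Re z\<close>.\<close>
      have "t - Re z * t - t\<^sup>2 / 2 \<le> (1 - Re z)\<^sup>2 / 2"
        using zero_le_power2[of "t - (1 - Re z)"] by (simp add: power2_eq_square algebra_simps)
      then show ?thesis by simp
    qed
  qed (auto intro!: continuous_intros)
  moreover have "exp (of_real t - z * of_real t - of_real (t\<^sup>2 / 2)) * (complex_of_real t powr (\<alpha> - 1/2) / of_real (exp t))
      = exp (- z * of_real t) * pcf_kernel \<alpha> t" for t
  proof -
    have "exp (of_real t - z * of_real t - of_real (t\<^sup>2 / 2))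
        = exp (- z * of_real t) * of_real (exp (- t\<^sup>2 / 2)) * of_real (exp t)"
      by (simp add: algebra_simps flip: exp_add exp_of_real)
    then show ?thesis by (simp add: pcf_kernel_def)
  qed
  ultimately show "(\<lambda>t. exp (- z * of_real t) * pcf_kernel \<alpha> t) absolutely_integrable_on {0..}"
    by (simp only:)
qed

lemma has_field_derivative_laplace_pcf_kernel:
  assumes "Re \<alpha> > -1/2"
  shows "(laplace (pcf_kernel \<alpha>) has_field_derivative - laplace (pcf_kernel (\<alpha> + 1)) z) (at z)"
proof -
  have "laplace (\<lambda>t. - of_real t * pcf_kernel \<alpha> t) z = - laplace (pcf_kernel (\<alpha> + 1)) z"
    unfolding laplace_def integral_neg[symmetric]
    by (intro Henstock_Kurzweil_Integration.integral_cong) (simp flip: pcf_kernel_Suc)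
  then show ?thesis
    using has_field_derivative_laplace[OF laplace_integrable_pcf_kernel[OF assms, of "Re z - 1"], of z] by simp
qed

lemma continuous_on_pcf_kernel:
  assumes "Re \<alpha> > 1/2"
  shows "continuous_on {0..} (pcf_kernel \<alpha>)"
proof -
  have "continuous (at x within {0..}) (pcf_kernel \<alpha>)" if x: "x \<ge> 0" for x
  proof (cases "x = 0")
    case False
    then have "isCont (pcf_kernel \<alpha>) x" using x unfolding pcf_kernel_def
      by (intro continuous_intros) (auto simp: complex_nonpos_Reals_iff)
    then show ?thesis by (rule continuous_at_imp_continuous_at_within)
  next
    case True
    have "((\<lambda>t. pcf_kernel \<alpha> t) \<longlongrightarrow> 0) (at 0 within {0..})"
    proof (rule Lim_null_comparison)
      show "\<forall>\<^sub>F t in at 0 within {0..}. norm (pcf_kernel \<alpha> t) \<le> t powr (Re \<alpha> - 1/2)"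
        by (auto simp: eventually_at pcf_kernel_def norm_mult norm_powr_real_powr intro!: exI[of _ 1] mult_left_le)
      show "((\<lambda>t. t powr (Re \<alpha> - 1/2)) \<longlongrightarrow> 0) (at 0 within {0..})"
        using assms by (auto intro!: tendsto_eq_intros simp: eventually_at intro!: exI[of _ 1])
    qed
    moreover have "pcf_kernel \<alpha> 0 = 0" by (simp add: pcf_kernel_def)
    ultimately show ?thesis using True by (simp add: continuous_within)
  qed
  then show ?thesis by (auto simp: continuous_on_eq_continuous_within)
qed

text \<open>The derivative of \<open>F\<close>, that is of \<open>t\<close> to the power
  \<open>\<alpha> + 1/2\<close> times \<open>exp (- z * t - t^2 / 2)\<close>, is the combination
  \<open>f\<close> of the three kernels, and \<open>F\<close> vanishes both at 0 and at
  infinity.\<close>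

lemma laplace_pcf_kernel_recurrence:
  assumes "Re \<alpha> > -1/2"
  shows "laplace (pcf_kernel (\<alpha> + 2)) z + z * laplace (pcf_kernel (\<alpha> + 1)) z
       = (\<alpha> + 1/2) * laplace (pcf_kernel \<alpha>) z"
proof -
  define F where "F = (\<lambda>t. exp (- z * of_real t) * pcf_kernel (\<alpha> + 1) t)"
  define f where "f = (\<lambda>t. (\<alpha> + 1/2) * (exp (- z * of_real t) * pcf_kernel \<alpha> t)
      - exp (- z * of_real t) * pcf_kernel (\<alpha> + 2) t - z * (exp (- z * of_real t) * pcf_kernel (\<alpha> + 1) t))"
  have i: "(\<lambda>t. exp (- z * of_real t) * pcf_kernel \<beta> t) absolutely_integrable_on {0..}" if "Re \<beta> > -1/2" for \<beta>
    by (rule laplace_integrableD[OF laplace_integrable_pcf_kernel[OF that, of "Re z - 1"]]) simp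
  have ii: "((\<lambda>t. exp (- z * of_real t) * pcf_kernel \<beta> t) has_integral laplace (pcf_kernel \<beta>) z) {0..}"
    if "Re \<beta> > -1/2" for \<beta>
    using i[OF that] by (auto simp: laplace_def absolutely_integrable_on_def intro: integrable_integral)
  have f: "(f has_integral ((\<alpha> + 1/2) * laplace (pcf_kernel \<alpha>) z
       - laplace (pcf_kernel (\<alpha> + 2)) z - z * laplace (pcf_kernel (\<alpha> + 1)) z)) {0..}"
    unfolding f_def by (intro has_integral_diff has_integral_mult_right ii) (use assms in auto)
  have "(F \<longlongrightarrow> F 0 + integral {0..} f) at_top"
  proof (rule tendsto_primitive_at_top)
    show "f absolutely_integrable_on {0..}" unfolding f_def
      by (intro set_integral_diff set_integrable_mult_right i) (use assms in auto)
    show "continuous_on {0..} F" unfolding F_def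
      by (intro continuous_intros continuous_on_pcf_kernel) (use assms in auto)
    fix t :: real assume t: "t > 0"
    \<comment> \<open>Differentiation is carried out on the complex extension \<open>h\<close> of
      \<open>F\<close>, where the rules for complex powers apply, and then restricted to the real
      line.\<close>
    define h where "h = (\<lambda>w. exp (- z * w) * (w powr (\<alpha> + 1/2) * exp (- w\<^sup>2 / 2)))"
    have "of_real t powr ((3 + \<alpha> * 2) / 2) = of_real t * of_real t powr ((1 + \<alpha> * 2) / 2)"
      using powr_add[of "of_real t" 1 "(1 + \<alpha> * 2) / 2"] by (simp add: add_divide_distrib)
    then have "(h has_field_derivative f t) (at (of_real t))"
      unfolding h_def f_def using t
      by (auto intro!: derivative_eq_intros simp: complex_nonpos_Reals_iff pcf_kernel_def powr_diff powr_add
               power2_eq_square exp_of_real[symmetric] divide_simps)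
         (simp add: algebra_simps)?
    then have "(h \<circ> of_real has_vector_derivative f t) (at t)"
      by (intro field_vector_diff_chain_at[of of_real 1 _ h, simplified])
         (auto intro!: derivative_eq_intros has_vector_derivative_of_real)
    moreover have "h \<circ> of_real = F"
      by (auto simp: fun_eq_iff F_def h_def pcf_kernel_def exp_of_real[symmetric] add.commute)
    ultimately show "(F has_vector_derivative f t) (at t)" by simp
  qed
  moreover have "(F \<longlongrightarrow> 0) at_top"
  proof (rule Lim_null_comparison)
    show "\<forall>\<^sub>F t in at_top. norm (F t) \<le> t powr (Re \<alpha> + 1/2) * exp (- Re z * t - t\<^sup>2 / 2)"
      using eventually_gt_at_top[of 0]
    proof eventually_elim
      case (elim t)
      have "exp (- Re z * t - t\<^sup>2 / 2) = exp (- Re z * t) * exp (- t\<^sup>2 / 2)"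
        by (simp flip: exp_add)
      then show ?case using elim
        by (simp add: F_def norm_mult pcf_kernel_def norm_powr_real_powr add.commute)
    qed
    show "((\<lambda>t. t powr (Re \<alpha> + 1/2) * exp (- Re z * t - t\<^sup>2 / 2)) \<longlongrightarrow> 0) at_top"
      by real_asymp
  qed
  ultimately have "F 0 + integral {0..} f = 0"
    by (intro tendsto_unique[of at_top F]) auto
  then show ?thesis
    using integral_unique[OF f] by (simp add: F_def pcf_kernel_def algebra_simps)
qed

text \<open>The real-valued substitution rule is applied to the real and the imaginary part, which
  are the two choices of \<open>h\<close>.\<close>

lemma integral_change_of_variables_complex:
  fixes f :: "real \<Rightarrow> complex" and g g' :: "real \<Rightarrow> real"
  assumes "S \<in> sets lebesgue"
    and "\<And>x. x \<in> S \<Longrightarrow> (g has_field_derivative g' x) (at x within S)" "inj_on g S"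
    and f: "f absolutely_integrable_on (g ` S)"
    and fg: "(\<lambda>x. of_real \<bar>g' x\<bar> * f (g x)) absolutely_integrable_on S"
  shows "integral S (\<lambda>x. of_real \<bar>g' x\<bar> * f (g x)) = integral (g ` S) f"
proof -
  have *: "h (integral S (\<lambda>x. of_real \<bar>g' x\<bar> * f (g x))) = h (integral (g ` S) f)"
    if h: "bounded_linear h" and hm: "\<And>c x. h (of_real c * x) = c * h x" for h :: "complex \<Rightarrow> real"
  proof -
    have 1: "(h \<circ> f) absolutely_integrable_on (g ` S)"
      by (rule absolutely_integrable_linear[OF f h])
    have "integral S (\<lambda>x. \<bar>g' x\<bar> * (h \<circ> f) (g x)) = integral (g ` S) (h \<circ> f)"
      using has_absolute_integral_change_of_variables_1'[of S g g' "h \<circ> f" "integral (g ` S) (h \<circ> f)"] assms 1 by blast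
    also have "\<dots> = h (integral (g ` S) f)"
      using f by (intro integral_linear h) (auto simp: absolutely_integrable_on_def)
    also have "(\<lambda>x. \<bar>g' x\<bar> * (h \<circ> f) (g x)) = h \<circ> (\<lambda>x. of_real \<bar>g' x\<bar> * f (g x))"
      by (simp add: hm fun_eq_iff)
    also have "integral S \<dots> = h (integral S (\<lambda>x. of_real \<bar>g' x\<bar> * f (g x)))"
      using fg by (intro integral_linear h) (auto simp: absolutely_integrable_on_def)
    finally show ?thesis .
  qed
  show ?thesis
    using *[OF bounded_linear_Re] *[OF bounded_linear_Im] by (intro complex_eqI) auto
qed

text \<open>Substituting \<open>v = t^2 / 2\<close> in the Gamma integral at
  \<open>\<alpha>/2 + 1/4\<close> produces the kernel up to a power of 2.\<close>

lemma laplace_pcf_kernel_0: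
  assumes "Re \<alpha> > -1/2"
  shows "laplace (pcf_kernel \<alpha>) 0 = 2 powr (\<alpha>/2 - 3/4) * Gamma (\<alpha>/2 + 1/4)"
proof -
  define f where "f = (\<lambda>v. complex_of_real v powr (\<alpha>/2 + 1/4 - 1) / of_real (exp v))"
  define g where "g = (\<lambda>t::real. t\<^sup>2 / 2)"
  have img: "g ` {0<..} = {0<..}"
  proof (intro equalityI subsetI)
    fix v :: real assume "v \<in> {0<..}"
    then show "v \<in> g ` {0<..}" by (intro image_eqI[of _ _ "sqrt (2 * v)"]) (auto simp: g_def)
  qed (auto simp: g_def)
  have open_closed: "integral {0<..} h = integral {0..} h" for h :: "real \<Rightarrow> complex"
  proof (rule integral_subset_negligible)
    show "negligible ({0..} - {0<..} :: real set)"
      by (rule negligible_subset[of "{0}"]) auto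
  qed auto
  have fg: "of_real \<bar>t\<bar> * f (g t) = 2 powr (3/4 - \<alpha>/2) * pcf_kernel \<alpha> t" if "t > 0" for t
  proof -
    have pos: "t\<^sup>2 / 2 > 0" using that by simp
    \<comment> \<open>Powers of positive reals become exponentials of real logarithms, so exponents
      can be added without branch questions.\<close>
    have real_powr: "complex_of_real x powr \<beta> = exp (\<beta> * of_real (ln x))" if "x > 0" for x \<beta>
      using that by (simp add: powr_def Ln_of_real)
    have "of_real \<bar>t\<bar> * f (g t) = exp (of_real (ln t)) * complex_of_real (t\<^sup>2 / 2) powr (\<alpha>/2 - 3/4) / exp (of_real (t\<^sup>2 / 2))"
      using that by (simp add: f_def g_def exp_of_real del: of_real_divide of_real_power)
    also have "\<dots> = exp (of_real (ln t) + (\<alpha>/2 - 3/4) * of_real (2 * ln t - ln 2) - of_real (t\<^sup>2 / 2))"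
      using that unfolding real_powr[OF pos] exp_add exp_diff
      by (simp add: ln_div ln_realpow)
    also have "of_real (ln t) + (\<alpha>/2 - 3/4) * of_real (2 * ln t - ln 2) - of_real (t\<^sup>2 / 2)
       = (3/4 - \<alpha>/2) * of_real (ln 2) + ((\<alpha> - 1/2) * of_real (ln t) + of_real (- t\<^sup>2 / 2))"
      by (simp add: field_simps)
    also have "exp \<dots> = 2 powr (3/4 - \<alpha>/2) * pcf_kernel \<alpha> t"
      using real_powr[of 2 "3/4 - \<alpha>/2"] real_powr[OF that, of "\<alpha> - 1/2"]
      unfolding exp_add exp_of_real by (simp add: pcf_kernel_def)
    finally show ?thesis .
  qed
  have f: "f absolutely_integrable_on (g ` {0<..})"
    unfolding img f_def using absolutely_integrable_Gamma_integral[of "\<alpha>/2 + 1/4" 1] assms by simp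
  have k: "(\<lambda>t. 2 powr (3/4 - \<alpha>/2) * pcf_kernel \<alpha> t) absolutely_integrable_on {0<..}"
  proof (rule set_integrable_mult_right)
    have "pcf_kernel \<alpha> absolutely_integrable_on {0..}"
      using laplace_integrableD[OF laplace_integrable_pcf_kernel[OF assms, of "-1"], of 0] by simp
    then show "pcf_kernel \<alpha> absolutely_integrable_on {0<..}"
      by (rule set_integrable_subset) auto
  qed
  have "Gamma (\<alpha>/2 + 1/4) = integral {0..} f"
    unfolding f_def using Gamma_integral_complex[of "\<alpha>/2 + 1/4"] assms by (simp add: integral_unique)
  also have "\<dots> = integral {0<..} (\<lambda>t. of_real \<bar>t\<bar> * f (g t))"
  proof -
    have "(\<lambda>t. of_real \<bar>t\<bar> * f (g t)) absolutely_integrable_on {0<..} \<longleftrightarrow>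
        (\<lambda>t. 2 powr (3/4 - \<alpha>/2) * pcf_kernel \<alpha> t) absolutely_integrable_on {0<..}"
      by (rule set_integrable_cong[OF refl refl], rule fg) simp
    with k have "(\<lambda>t. of_real \<bar>t\<bar> * f (g t)) absolutely_integrable_on {0<..}" by blast
    then have "integral {0<..} (\<lambda>t. of_real \<bar>t\<bar> * f (g t)) = integral (g ` {0<..}) f"
      by (intro integral_change_of_variables_complex f)
         (auto simp: g_def inj_on_def intro!: derivative_eq_intros)
    then show ?thesis by (simp add: img open_closed)
  qed
  also have "\<dots> = integral {0<..} (\<lambda>t. 2 powr (3/4 - \<alpha>/2) * pcf_kernel \<alpha> t)"
    by (intro Henstock_Kurzweil_Integration.integral_cong fg) simp
  also have "\<dots> = 2 powr (3/4 - \<alpha>/2) * laplace (pcf_kernel \<alpha>) 0"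
    by (simp add: open_closed laplace_def)
  finally show ?thesis
    by (simp add: powr_diff)
qed

section \<open>Identification of \<open>U\<close> with its integral representation\<close>

definition pcf :: "complex \<Rightarrow> complex \<Rightarrow> complex" where
  "pcf \<alpha> z = rGamma (\<alpha> + 1/2) * exp (- z\<^sup>2 / 4) * laplace (pcf_kernel \<alpha>) z"

definition pcf' :: "complex \<Rightarrow> complex \<Rightarrow> complex" where
  "pcf' \<alpha> z = - rGamma (\<alpha> + 1/2) * exp (- z\<^sup>2 / 4) *
     (laplace (pcf_kernel (\<alpha> + 1)) z + z / 2 * laplace (pcf_kernel \<alpha>) z)"

text \<open>Each differentiation raises the kernel parameter by 1; the recurrence removes the term
  with \<open>\<alpha> + 2\<close> that appears in the second derivative.\<close>

lemma pcf_ode: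
  assumes "Re \<alpha> > -1/2"
  shows "(pcf \<alpha> has_field_derivative pcf' \<alpha> z) (at z)"
    and "(pcf' \<alpha> has_field_derivative (z\<^sup>2 / 4 + \<alpha>) * pcf \<alpha> z) (at z)"
proof -
  have a1: "Re (\<alpha> + 1) > -1/2" using assms by simp
  note D = has_field_derivative_laplace_pcf_kernel[OF assms] has_field_derivative_laplace_pcf_kernel[OF a1]
  show "(pcf \<alpha> has_field_derivative pcf' \<alpha> z) (at z)"
    unfolding pcf_def[abs_def] pcf'_def by (auto intro!: derivative_eq_intros D simp: algebra_simps)
  have rec: "laplace (pcf_kernel (\<alpha> + 1 + 1)) z
      = (\<alpha> + 1/2) * laplace (pcf_kernel \<alpha>) z - z * laplace (pcf_kernel (\<alpha> + 1)) z"
    using laplace_pcf_kernel_recurrence[OF assms, of z] by (simp add: algebra_simps)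
  have "(pcf' \<alpha> has_field_derivative
      rGamma (\<alpha> + 1/2) * exp (- z\<^sup>2 / 4) * (z / 2 * (laplace (pcf_kernel (\<alpha> + 1)) z + z / 2 * laplace (pcf_kernel \<alpha>) z)
        + laplace (pcf_kernel (\<alpha> + 1 + 1)) z - laplace (pcf_kernel \<alpha>) z / 2
        + z / 2 * laplace (pcf_kernel (\<alpha> + 1)) z)) (at z)"
    unfolding pcf'_def[abs_def]
    by (rule derivative_eq_intros D refl | simp)+ (simp add: algebra_simps)
  then show "(pcf' \<alpha> has_field_derivative (z\<^sup>2 / 4 + \<alpha>) * pcf \<alpha> z) (at z)"
    unfolding rec pcf_def by (simp add: algebra_simps power2_eq_square)
qed

lemma rGamma_nonzero_Re_pos: "Re z > 0 \<Longrightarrow> rGamma z \<noteq> 0"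
  by (auto simp: rGamma_eq_zero_iff nonpos_Ints_def)

text \<open>Legendre's duplication formula, arranged for the values at the origin: with
  \<open>w = \<alpha>/2 + 1/4\<close> the normalising factor of \<open>pcf\<close> is
  \<open>rGamma (2 * w)\<close>.\<close>

lemma Gamma_rGamma_double:
  fixes w :: complex
  assumes "Re w > 0"
  shows "Gamma w * rGamma (2 * w) = 2 powr (1 - 2 * w) * of_real (sqrt pi) * rGamma (w + 1/2)"
    and "Gamma (w + 1/2) * rGamma (2 * w) = 2 powr (1 - 2 * w) * of_real (sqrt pi) * rGamma w"
proof -
  have nz: "rGamma w \<noteq> 0" "rGamma (w + 1/2) \<noteq> 0" "rGamma (2 * w) \<noteq> 0"
    using assms by (intro rGamma_nonzero_Re_pos; simp)+
  then have "Gamma w * Gamma (w + 1/2) = 2 powr (1 - 2 * w) * of_real (sqrt pi) * Gamma (2 * w)"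
    by (subst Gamma_legendre_duplication) (auto simp: rGamma_eq_zero_iff powr_def Ln_of_real[of 2, simplified])
  with nz show "Gamma w * rGamma (2 * w) = 2 powr (1 - 2 * w) * of_real (sqrt pi) * rGamma (w + 1/2)"
     "Gamma (w + 1/2) * rGamma (2 * w) = 2 powr (1 - 2 * w) * of_real (sqrt pi) * rGamma w"
    by (auto simp: Gamma_def field_simps)
qed

lemma pcf_0:
  assumes "Re \<alpha> > -1/2"
  shows "pcf \<alpha> 0 = U0 \<alpha>" "pcf' \<alpha> 0 = U0' \<alpha>"
proof -
  define w where "w = \<alpha>/2 + 1/4"
  have w: "Re w > 0" "\<alpha> = 2 * w - 1/2" using assms by (auto simp: w_def field_simps)
  have a1: "Re (\<alpha> + 1) > -1/2" using assms by simp
  have exps: "\<alpha>/2 - 3/4 = w - 1" "\<alpha>/2 + 1/4 = w" "(\<alpha> + 1)/2 - 3/4 = w - 1/2" "(\<alpha> + 1)/2 + 1/4 = w + 1/2"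
    "\<alpha> + 1/2 = 2 * w" "3/4 + \<alpha>/2 = w + 1/2" "1/4 + \<alpha>/2 = w"
    "- (\<alpha>/2 + 1/4) = w - 1 + (1 - 2 * w)" "- (\<alpha>/2 - 1/4) = w - 1/2 + (1 - 2 * w)" by (simp_all add: w_def field_simps)
  have "pcf \<alpha> 0 = 2 powr (w - 1) * (Gamma w * rGamma (2 * w))"
    unfolding pcf_def laplace_pcf_kernel_0[OF assms] exps by simp
  also have "\<dots> = 2 powr (w - 1 + (1 - 2 * w)) * of_real (sqrt pi) * rGamma (w + 1/2)"
    unfolding Gamma_rGamma_double(1)[OF w(1)] powr_add by simp
  also have "\<dots> = U0 \<alpha>" unfolding U0_def exps by simp
  finally show "pcf \<alpha> 0 = U0 \<alpha>" .
  have "pcf' \<alpha> 0 = - (2 powr (w - 1/2) * (Gamma (w + 1/2) * rGamma (2 * w)))"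
    unfolding pcf'_def laplace_pcf_kernel_0[OF a1] exps by simp
  also have "\<dots> = - (2 powr (w - 1/2 + (1 - 2 * w)) * of_real (sqrt pi) * rGamma w)"
    unfolding Gamma_rGamma_double(2)[OF w(1)] powr_add by simp
  also have "\<dots> = U0' \<alpha>" unfolding U0'_def exps by simp
  finally show "pcf' \<alpha> 0 = U0' \<alpha>" .
qed

lemma pcf_0_nonzero:
  assumes "Re \<alpha> > -1/2"
  shows "pcf \<alpha> 0 \<noteq> 0" "pcf' \<alpha> 0 \<noteq> 0"
  using assms by (auto simp: pcf_0 U0_def U0'_def intro!: rGamma_nonzero_Re_pos)

lemma U_eq_pcf:
  assumes "Re \<alpha> > -1/2"
  shows "U \<alpha> = pcf \<alpha>"
  unfolding U_def
proof (rule the_equality)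
  note ode = pcf_ode[OF assms]
  show "\<exists>f'. (\<forall>z. (pcf \<alpha> has_field_derivative f' z) (at z) \<and>
      (f' has_field_derivative (z\<^sup>2 / 4 + \<alpha>) * pcf \<alpha> z) (at z)) \<and> pcf \<alpha> 0 = U0 \<alpha> \<and> f' 0 = U0' \<alpha>"
    using ode pcf_0[OF assms] by blast
  fix f assume "\<exists>f'. (\<forall>z. (f has_field_derivative f' z) (at z) \<and>
      (f' has_field_derivative (z\<^sup>2 / 4 + \<alpha>) * f z) (at z)) \<and> f 0 = U0 \<alpha> \<and> f' 0 = U0' \<alpha>"
  then obtain f' where f: "\<And>z. (f has_field_derivative f' z) (at z)"
     "\<And>z. (f' has_field_derivative (z\<^sup>2 / 4 + \<alpha>) * f z) (at z)" "f 0 = U0 \<alpha>" "f' 0 = U0' \<alpha>" by blast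
  \<comment> \<open>The equation is even in \<open>z\<close>, so \<open>pcf \<alpha> (- z)\<close>
    is a second solution. Its Wronskian with \<open>pcf \<alpha>\<close> at 0 is
    \<open>- 2 * pcf \<alpha> 0 * pcf' \<alpha> 0\<close>, which is nonzero.\<close>
  have r: "((\<lambda>z. pcf \<alpha> (- z)) has_field_derivative - pcf' \<alpha> (- z)) (at z)"
     "((\<lambda>z. - pcf' \<alpha> (- z)) has_field_derivative (z\<^sup>2 / 4 + \<alpha>) * pcf \<alpha> (- z)) (at z)" for z
    using DERIV_chain'[OF DERIV_minus[OF DERIV_ident] ode(1), of z UNIV]
      DERIV_minus[OF DERIV_chain'[OF DERIV_minus[OF DERIV_ident] ode(2), of z UNIV]]
    by auto
  show "f = pcf \<alpha>"
    by (rule linear_ode_unique[OF f(1,2) ode ode r])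
       (use f(3,4) pcf_0[OF assms] pcf_0_nonzero[OF assms] in auto)
qed

text \<open>In the closed right half-plane the Laplace integrals are bounded by the integrals of the
  absolute values at abscissa 0. What remains is the factor \<open>exp (- z^2 / 4)\<close>, and for
  the derivative a linear factor as well.\<close>

lemma pcf_bound:
  assumes "Re \<alpha> > -1/2"
  shows "\<exists>C. \<forall>z. Re z \<ge> 0 \<longrightarrow> norm (pcf \<alpha> z) \<le> C * exp (- Re (z\<^sup>2) / 4)
     \<and> norm (pcf' \<alpha> z) \<le> C * (1 + norm z) * exp (- Re (z\<^sup>2) / 4)"
proof -
  have "\<exists>C\<ge>0. \<forall>z. Re z \<ge> 0 \<longrightarrow> norm (laplace (pcf_kernel \<beta>) z) \<le> C" if "Re \<beta> > -1/2" for \<beta>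
  proof (intro exI conjI allI impI)
    show "norm (laplace (pcf_kernel \<beta>) z) \<le> \<bar>integral {0..} (\<lambda>t. norm (exp (- of_real 0 * of_real t) * pcf_kernel \<beta> t))\<bar>"
      if "Re z \<ge> 0" for z
      using norm_laplace_le[OF laplace_integrable_pcf_kernel[OF \<open>Re \<beta> > -1/2\<close>, of "-1"], of 0 z] that by simp
  qed simp
  from this[OF assms] this[of "\<alpha> + 1"] assms obtain C C' where
    C: "C \<ge> 0" "\<And>z. Re z \<ge> 0 \<Longrightarrow> norm (laplace (pcf_kernel \<alpha>) z) \<le> C" and
    C': "C' \<ge> 0" "\<And>z. Re z \<ge> 0 \<Longrightarrow> norm (laplace (pcf_kernel (\<alpha> + 1)) z) \<le> C'" by auto
  define M where "M = norm (rGamma (\<alpha> + 1/2)) * (C + C')"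
  have e: "norm (exp (- z\<^sup>2 / 4)) = exp (- Re (z\<^sup>2) / 4)" for z by simp
  have "norm (pcf \<alpha> z) \<le> M * exp (- Re (z\<^sup>2) / 4) \<and>
     norm (pcf' \<alpha> z) \<le> M * (1 + norm z) * exp (- Re (z\<^sup>2) / 4)" if z: "Re z \<ge> 0" for z
  proof
    have "norm (pcf \<alpha> z) = norm (rGamma (\<alpha> + 1/2)) * exp (- Re (z\<^sup>2) / 4) * norm (laplace (pcf_kernel \<alpha>) z)"
      by (simp only: pcf_def norm_mult e)
    also have "\<dots> \<le> norm (rGamma (\<alpha> + 1/2)) * exp (- Re (z\<^sup>2) / 4) * (C + C')"
      using C(2)[OF z] C'(1) by (intro mult_left_mono) auto
    finally show "norm (pcf \<alpha> z) \<le> M * exp (- Re (z\<^sup>2) / 4)" by (simp add: M_def mult_ac)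
    have "norm (laplace (pcf_kernel (\<alpha> + 1)) z + z / 2 * laplace (pcf_kernel \<alpha>) z) \<le> C' + norm z / 2 * C"
      using C(2)[OF z] C'(2)[OF z]
      by (intro order.trans[OF norm_triangle_ineq] add_mono) (auto simp: norm_mult norm_divide intro!: mult_left_mono)
    also have "\<dots> \<le> (C + C') * (1 + norm z)" using C(1) C'(1) by (simp add: algebra_simps)
    finally have "norm (rGamma (\<alpha> + 1/2)) * exp (- Re (z\<^sup>2) / 4) *
          norm (laplace (pcf_kernel (\<alpha> + 1)) z + z / 2 * laplace (pcf_kernel \<alpha>) z)
        \<le> norm (rGamma (\<alpha> + 1/2)) * exp (- Re (z\<^sup>2) / 4) * ((C + C') * (1 + norm z))"
      by (intro mult_left_mono) auto
    then show "norm (pcf' \<alpha> z) \<le> M * (1 + norm z) * exp (- Re (z\<^sup>2) / 4)"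
      by (simp only: pcf'_def norm_mult norm_minus_cancel e) (simp add: M_def mult_ac)
  qed
  then show ?thesis by blast
qed

section \<open>Weber's equation\<close>

lemma absolutely_integrable_exp_bound:
  fixes f :: "real \<Rightarrow> complex"
  assumes "continuous_on {0..} f" and "\<And>t. t \<ge> 0 \<Longrightarrow> norm (f t) \<le> B * exp (- c * t)" and "c > 0"
  shows "f absolutely_integrable_on {0..}"
proof (rule measurable_bounded_by_integrable_imp_absolutely_integrable)
  show "f \<in> borel_measurable (lebesgue_on {0..})"
    by (intro continuous_imp_measurable_on_sets_lebesgue assms(1)) auto
  show "(\<lambda>t. B * exp (- c * t)) integrable_on {0..}"
    using integrable_on_exp_minus_to_infinity[OF assms(3)] by (intro integrable_on_mult_right) auto
qed (use assms in auto)

lemma Re_of_real_mult: "Re (of_real x * z) = x * Re z"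
  by simp

text \<open>The two directions \<open>e\<^bsup>\<plusminus>i\<pi>/4\<^esup>\<close> along which \<open>W\<^sub>0\<close> and \<open>W\<^sub>3\<close> are recessive,
  encoded by \<open>d\<^sup>2 = \<plusminus>i\<close>.\<close>

definition recessive_direction :: "complex \<Rightarrow> bool" where
  "recessive_direction d \<longleftrightarrow> Re d > 0 \<and> (d\<^sup>2 = \<i> \<or> d\<^sup>2 = - \<i>)"

lemma recessive_directionD:
  assumes "recessive_direction d"
  shows "Re d > 0" "norm d = 1" "d \<noteq> 0" "Re (d\<^sup>2) = 0" "d ^ 4 = -1" "Re (1 / d) > 0"
proof -
  have "d ^ 4 = (d\<^sup>2)\<^sup>2" by simp
  also have "\<dots> = -1" using assms unfolding recessive_direction_def
    by (elim conjE disjE) (simp_all only: power2_minus power2_i)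
  finally show d4: "d ^ 4 = -1" .
  from assms show 1: "Re d > 0" "Re (d\<^sup>2) = 0" "d \<noteq> 0"
    by (auto simp: recessive_direction_def)
  have "norm d ^ 4 = 1" using d4 by (metis norm_minus_cancel norm_one norm_power)
  then show 2: "norm d = 1" using power_eq_iff_eq_base[of 4 "norm d" 1] by simp
  show "Re (1 / d) > 0" using 1 2 by (simp add: Re_divide cmod_power2[symmetric])
qed

text \<open>Since \<open>d^4 = -1\<close>, the rotation \<open>z / d\<close> together with the
  parameter \<open>a * d^2\<close> turns the equation of \<open>pcf\<close> into Weber's equation.
  One formula covers \<open>Wj 0\<close> and \<open>Wj 3\<close>; positive multiples of
  \<open>d\<close> are mapped to positive reals, where \<open>pcf\<close> decays.\<close>

definition weber :: "real \<Rightarrow> complex \<Rightarrow> complex \<Rightarrow> complex" where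
  "weber a d z = pcf (of_real a * d\<^sup>2) (z / d)"

definition weber' :: "real \<Rightarrow> complex \<Rightarrow> complex \<Rightarrow> complex" where
  "weber' a d z = pcf' (of_real a * d\<^sup>2) (z / d) / d"

lemma weber_ode:
  assumes "recessive_direction d"
  shows "(weber a d has_field_derivative weber' a d z) (at z)"
    and "(weber' a d has_field_derivative (of_real a - z\<^sup>2 / 4) * weber a d z) (at z)"
proof -
  note d = recessive_directionD[OF assms]
  have \<alpha>: "Re (of_real a * d\<^sup>2) > -1/2" using d(4) by (simp add: Re_of_real_mult)
  have div: "((\<lambda>z. z / d) has_field_derivative 1 / d) (at z)"
    by (auto intro!: derivative_eq_intros simp: d)
  show "(weber a d has_field_derivative weber' a d z) (at z)"
    using DERIV_chain'[OF div pcf_ode(1)[OF \<alpha>]]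
    by (simp add: weber_def[abs_def] weber'_def)
  have "(weber' a d has_field_derivative ((z / d)\<^sup>2 / 4 + of_real a * d\<^sup>2) * weber a d z / d\<^sup>2) (at z)"
    using DERIV_cdivide[OF DERIV_chain'[OF div pcf_ode(2)[OF \<alpha>]], of d]
    by (simp add: weber_def weber'_def[abs_def] power2_eq_square)
  also have "((z / d)\<^sup>2 / 4 + of_real a * d\<^sup>2) * weber a d z / d\<^sup>2 = (of_real a - z\<^sup>2 / 4) * weber a d z"
  proof -
    have "((z / d)\<^sup>2 / 4 + of_real a * d\<^sup>2) / d\<^sup>2 = z\<^sup>2 / d ^ 4 / 4 + of_real a"
      using d(3) by (simp add: field_simps power4_eq_xxxx power2_eq_square)
    also have "\<dots> = of_real a - z\<^sup>2 / 4" by (simp add: d(5))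
    finally show ?thesis by (simp only: times_divide_eq_left [symmetric])
  qed
  finally show "(weber' a d has_field_derivative (of_real a - z\<^sup>2 / 4) * weber a d z) (at z)" .
qed

lemma weber_bound:
  assumes "recessive_direction d"
  shows "\<exists>C\<ge>0. \<forall>z. Re (z / d) \<ge> 0 \<longrightarrow> norm (weber a d z) \<le> C * exp (- Re ((z / d)\<^sup>2) / 4)
     \<and> norm (weber' a d z) \<le> C * (1 + norm z) * exp (- Re ((z / d)\<^sup>2) / 4)"
proof -
  note d = recessive_directionD[OF assms]
  have "Re (of_real a * d\<^sup>2) > -1/2" using d(4) by (simp add: Re_of_real_mult)
  from pcf_bound[OF this] obtain C where C: "\<And>z. Re z \<ge> 0 \<Longrightarrow>
      norm (pcf (of_real a * d\<^sup>2) z) \<le> C * exp (- Re (z\<^sup>2) / 4)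
     \<and> norm (pcf' (of_real a * d\<^sup>2) z) \<le> C * (1 + norm z) * exp (- Re (z\<^sup>2) / 4)" by blast
  moreover have "C \<ge> 0" using C[of 0] order.trans[OF norm_ge_zero] by fastforce
  ultimately show ?thesis
  proof (intro exI[of _ C] conjI allI impI)
    fix z assume "Re (z / d) \<ge> 0"
    from C[OF this] show "norm (weber a d z) \<le> C * exp (- Re ((z / d)\<^sup>2) / 4)"
      "norm (weber' a d z) \<le> C * (1 + norm z) * exp (- Re ((z / d)\<^sup>2) / 4)"
      using d(2) by (simp_all add: weber_def weber'_def norm_divide)
  qed
qed

lemma weber_ray_bound:
  assumes "recessive_direction d"
  obtains C where "C \<ge> 0" "\<And>r. r \<ge> 0 \<Longrightarrow> norm (weber a d (of_real r * d)) \<le> C * exp (- r\<^sup>2 / 4)"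
    "\<And>r. r \<ge> 0 \<Longrightarrow> norm (weber' a d (of_real r * d)) \<le> C * (1 + r) * exp (- r\<^sup>2 / 4)"
proof -
  note d = recessive_directionD[OF assms]
  obtain C where C: "C \<ge> 0" "\<And>z. Re (z / d) \<ge> 0 \<Longrightarrow> norm (weber a d z) \<le> C * exp (- Re ((z / d)\<^sup>2) / 4)"
     "\<And>z. Re (z / d) \<ge> 0 \<Longrightarrow> norm (weber' a d z) \<le> C * (1 + norm z) * exp (- Re ((z / d)\<^sup>2) / 4)"
    using weber_bound[OF assms] by blast
  show ?thesis
    by (rule that[OF C(1)]) (use C(2,3)[of "of_real r * d" for r] d in \<open>auto simp: norm_mult\<close>)
qed

text \<open>For real \<open>x\<close> the square of \<open>x / d\<close> is purely imaginary, so the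
  exponential in \<open>weber_bound\<close> equals 1; for \<open>x \<ge> 0\<close> the point
  \<open>x / d\<close> is in the closed right half-plane because
  \<open>Re (1 / d) > 0\<close>.\<close>

lemma weber_real_bound:
  assumes "recessive_direction d"
  obtains C where "C \<ge> 0" "\<And>x. x \<ge> 0 \<Longrightarrow> norm (weber a d (of_real x)) \<le> C"
    "\<And>x. x \<ge> 0 \<Longrightarrow> norm (weber' a d (of_real x)) \<le> C * (1 + x)"
proof -
  note d = recessive_directionD[OF assms]
  have re: "Re (of_real x / d) \<ge> 0" "Re ((of_real x / d)\<^sup>2) = 0" if "x \<ge> 0" for x :: real
  proof -
    have "of_real x / d = of_real x * (1 / d)" by simp
    then show "Re (of_real x / d) \<ge> 0" using d(6) that by (simp only: Re_of_real_mult) simp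
    have "1 / d\<^sup>2 = - d\<^sup>2" using d(3,5) by (simp add: field_simps power4_eq_xxxx power2_eq_square)
    then have "(of_real x / d)\<^sup>2 = of_real (x\<^sup>2) * (- d\<^sup>2)" by (simp add: power_divide divide_inverse power_mult_distrib power_inverse)
    then show "Re ((of_real x / d)\<^sup>2) = 0" using d(4) by (simp only: Re_of_real_mult) simp
  qed
  obtain C where C: "C \<ge> 0" "\<And>z. Re (z / d) \<ge> 0 \<Longrightarrow> norm (weber a d z) \<le> C * exp (- Re ((z / d)\<^sup>2) / 4)"
     "\<And>z. Re (z / d) \<ge> 0 \<Longrightarrow> norm (weber' a d z) \<le> C * (1 + norm z) * exp (- Re ((z / d)\<^sup>2) / 4)"
    using weber_bound[OF assms] by blast
  show ?thesis
  proof (rule that[OF C(1)])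
    fix x :: real assume x: "x \<ge> 0"
    show "norm (weber a d (of_real x)) \<le> C" "norm (weber' a d (of_real x)) \<le> C * (1 + x)"
      using C(2,3)[OF re(1)[OF x]] re(2)[OF x] x by simp_all
  qed
qed

section \<open>The functions \<open>Wj 0\<close> and \<open>Wj 3\<close> and their Wronskian\<close>

definition dir0 :: complex where "dir0 = exp (\<i> * of_real pi / 4)"
definition dir3 :: complex where "dir3 = exp (- \<i> * of_real pi / 4)"

lemma dir_inverse: "dir0 \<noteq> 0" "dir3 = 1 / dir0"
  by (simp_all add: dir0_def dir3_def exp_minus field_simps)

lemma dir_power2: "dir0\<^sup>2 = \<i>" "dir3\<^sup>2 = - \<i>"
proof -
  have "dir0\<^sup>2 = exp (\<i> * of_real (pi / 2))"
    by (simp add: dir0_def power2_eq_square flip: exp_add)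
  then show "dir0\<^sup>2 = \<i>" using cis_pi_half by (simp add: cis_conv_exp)
  then show "dir3\<^sup>2 = - \<i>" by (simp add: dir_inverse power_divide)
qed

lemma recessive_direction_dir: "recessive_direction dir0" "recessive_direction dir3"
  using dir_power2 by (auto simp: recessive_direction_def dir0_def dir3_def Re_exp cos_45)

lemma Wj_eq_weber: "Wj 0 a = weber a dir0" "Wj 3 a = weber a dir3"
proof -
  have e: "exp (- \<i> * of_real pi / 4) = 1 / dir0"
    using dir_inverse(2) by (simp add: dir3_def)
  \<comment> \<open>Hence the rotation factor in \<open>Wj 3\<close>, namely
    \<open>(- \<i>) ^ 3 / dir0\<close>, equals \<open>1 / dir3\<close>.\<close>
  have "\<i> / dir0 = dir0" using dir_power2(1) dir_inverse(1) by (simp add: field_simps power2_eq_square)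
  then have i: "\<i> * z * (1 / dir0) = z / dir3" for z
  proof -
    have "\<i> * z * (1 / dir0) = (\<i> / dir0) * z" by simp
    also have "\<dots> = z / dir3" unfolding \<open>\<i> / dir0 = dir0\<close> by (simp add: dir_inverse(2))
    finally show ?thesis .
  qed
  have m: "(- \<i>) ^ 3 = \<i>" "(- 1) ^ 3 * \<i> * of_real a = of_real a * (- \<i>)" by (simp_all add: power3_eq_cube)
  show "Wj 0 a = weber a dir0"
    unfolding Wj_def[abs_def] weber_def[abs_def] dir_power2 e by (subst U_eq_pcf) (simp_all add: mult.commute)
  show "Wj 3 a = weber a dir3"
    unfolding Wj_def[abs_def] weber_def[abs_def] dir_power2 e m i by (subst U_eq_pcf) simp_all
qed

text \<open>The powers of 2 cancel and the reflection formula combines the reciprocal Gamma values.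
  The Wronskian of \<open>Wj 0\<close> and \<open>Wj 3\<close> at 0 is built from two such
  products.\<close>

lemma U0_U0'_product: "U0 \<alpha> * U0' (- \<alpha>) = - sin (of_real pi * (1/4 - \<alpha>/2))"
proof -
  have "U0 \<alpha> * U0' (- \<alpha>) = - (of_real (sqrt pi) * of_real (sqrt pi)) * (2 powr (- (\<alpha>/2 + 1/4)) * 2 powr (\<alpha>/2 + 1/4))
     * (rGamma (1/4 - \<alpha>/2) * rGamma (1 - (1/4 - \<alpha>/2)))"
    by (simp add: U0_def U0'_def algebra_simps)
  also have "(of_real (sqrt pi) * of_real (sqrt pi) :: complex) = of_real pi"
    by (simp flip: of_real_mult)
  also have "(2 powr (- (\<alpha>/2 + 1/4)) * 2 powr (\<alpha>/2 + 1/4) :: complex) = 1"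
    by (simp flip: powr_add)
  finally show ?thesis
    unfolding rGamma_reflection_complex by simp
qed

text \<open>The Wronskian is constant, and its value \<open>- \<i> * exp (- pi * a / 2)\<close>,
  computed at 0, explains the prefactor in \<open>NK\<close>.\<close>

lemma weber_wronskian:
  "\<i> * exp (of_real (pi * a / 2)) * (weber' a dir3 z * weber a dir0 z - weber' a dir0 z * weber a dir3 z) = 1"
proof -
  define E where "E = dir0"
  define T where "T = exp (- of_real (pi * a / 2) :: complex)"
  note r = recessive_direction_dir
  have E: "E \<noteq> 0" "E\<^sup>2 = \<i>" "dir3 = 1 / E" using dir_power2 dir_inverse by (auto simp: E_def)
  have T: "T \<noteq> 0" "exp (of_real (pi * a / 2)) = 1 / T" by (auto simp: T_def exp_minus field_simps)
  have pos: "Re (of_real a * \<i>) > -1/2" "Re (- (of_real a * \<i>)) > -1/2" by auto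
  have "weber' a dir3 z * weber a dir0 z - weber' a dir0 z * weber a dir3 z
     = weber' a dir3 0 * weber a dir0 0 - weber' a dir0 0 * weber a dir3 0"
    using wronskian_const[OF weber_ode[OF r(1)] weber_ode[OF r(2)], of a z] by (simp add: mult.commute)
  also have "\<dots> = (U0 (of_real a * \<i>) * U0' (- (of_real a * \<i>))) * E - (U0 (- (of_real a * \<i>)) * U0' (- (- (of_real a * \<i>)))) / E"
    unfolding weber_def weber'_def dir_power2
    unfolding E(3) E_def[symmetric]
    using pcf_0[OF pos(1)] pcf_0[OF pos(2)] by (simp add: field_simps)
  also have "\<dots> = - \<i> * T"
  \<comment> \<open>Both sines become rational in \<open>E\<close> and \<open>T\<close>; the terms
    in \<open>1 / T\<close> cancel because \<open>E^2 = \<i>\<close>.\<close>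
  proof -
    have sin_exp: "sin x = (v - 1 / v) / (2 * \<i>)" if "exp (\<i> * x) = v" for x v
      using that by (simp add: sin_exp_eq exp_minus inverse_eq_divide)
    have s1: "sin (of_real pi * (1/4 - of_real a * \<i> / 2)) = (E / T - 1 / (E / T)) / (2 * \<i>)"
    proof (rule sin_exp)
      have "\<i> * (of_real pi * (1/4 - of_real a * \<i> / 2)) = \<i> * of_real pi / 4 - (- of_real (pi * a / 2))"
        by (simp add: algebra_simps)
      then show "exp (\<i> * (of_real pi * (1/4 - of_real a * \<i> / 2))) = E / T"
        by (simp only: E_def T_def dir0_def exp_diff)
    qed
    have s2: "sin (of_real pi * (1/4 - (- (of_real a * \<i>)) / 2)) = (E * T - 1 / (E * T)) / (2 * \<i>)"
    proof (rule sin_exp)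
      have "\<i> * (of_real pi * (1/4 - (- (of_real a * \<i>)) / 2)) = \<i> * of_real pi / 4 + (- of_real (pi * a / 2))"
        by (simp add: algebra_simps)
      then show "exp (\<i> * (of_real pi * (1/4 - (- (of_real a * \<i>)) / 2))) = E * T"
        by (simp only: E_def T_def dir0_def exp_add)
    qed
    have "- ((E / T - 1 / (E / T)) / (2 * \<i>)) * E = (T - E\<^sup>2 / T) / (2 * \<i>)"
      using E(1) T(1) by (simp add: field_simps power2_eq_square)
    moreover have "- ((E * T - 1 / (E * T)) / (2 * \<i>)) / E = - ((T - 1 / (E\<^sup>2 * T)) / (2 * \<i>))"
      using E(1) T(1) by (simp add: field_simps power2_eq_square)
    moreover have "(T - \<i> / T) / (2 * \<i>) - - ((T - 1 / (\<i> * T)) / (2 * \<i>)) = - \<i> * T"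
      using T(1) by (simp add: field_simps)
    ultimately show ?thesis unfolding U0_U0'_product s1 s2 E(2) by (simp only:)
  qed
  finally show ?thesis using T by simp
qed

section \<open>Real solutions and \<open>W\<close> on the half-line\<close>

lemma real_weber_exists:
  fixes a p0 p1 :: real
  obtains f f' M where
    "\<And>x. (f has_field_derivative f' x) (at x)" "\<And>x. (f' has_field_derivative (a - x\<^sup>2 / 4) * f x) (at x)"
    "f 0 = p0" "f' 0 = p1" "\<And>x. x \<ge> 0 \<Longrightarrow> \<bar>f x\<bar> \<le> M" "\<And>x. x \<ge> 0 \<Longrightarrow> \<bar>f' x\<bar> \<le> M * (1 + x)"
proof -
  note r = recessive_direction_dir
  define k where "k = \<i> * exp (complex_of_real (pi * a / 2))"
  \<comment> \<open>Cramer's rule for the initial values \<open>p0\<close> and \<open>p1\<close>: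
    the determinant is the Wronskian, whose inverse is \<open>k\<close>.\<close>
  define c0 where "c0 = k * (of_real p0 * weber' a dir3 0 - of_real p1 * weber a dir3 0)"
  define c3 where "c3 = k * (of_real p1 * weber a dir0 0 - of_real p0 * weber' a dir0 0)"
  define h where "h = (\<lambda>z. c0 * weber a dir0 z + c3 * weber a dir3 z)"
  define h' where "h' = (\<lambda>z. c0 * weber' a dir0 z + c3 * weber' a dir3 z)"
  have h: "(h has_field_derivative h' z) (at z)" "(h' has_field_derivative (of_real a - z\<^sup>2 / 4) * h z) (at z)" for z
    unfolding h_def h'_def
    by (auto intro!: derivative_eq_intros weber_ode r simp: algebra_simps)
  \<comment> \<open>Weber's equation has real coefficients on the real line, so the real part of
    \<open>h\<close> is again a solution, and the bounds for \<open>weber\<close> pass to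
    it.\<close>
  have Re_deriv: "((\<lambda>x. Re (g (of_real x))) has_field_derivative Re g') (at x)"
    if "(g has_field_derivative g') (at (of_real x))" for g g' x
    using bounded_linear.has_vector_derivative[OF bounded_linear_Re has_vector_derivative_real_field[OF that]]
    by (simp add: has_real_derivative_iff_has_vector_derivative)
  have wr: "k * (weber' a dir3 0 * weber a dir0 0 - weber' a dir0 0 * weber a dir3 0) = 1"
    unfolding k_def by (rule weber_wronskian)
  have "h 0 = of_real p0 * (k * (weber' a dir3 0 * weber a dir0 0 - weber' a dir0 0 * weber a dir3 0))"
    "h' 0 = of_real p1 * (k * (weber' a dir3 0 * weber a dir0 0 - weber' a dir0 0 * weber a dir3 0))"
    unfolding h_def h'_def c0_def c3_def by (simp_all add: algebra_simps)
  then have init: "h 0 = of_real p0" "h' 0 = of_real p1" unfolding wr by simp_all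
  obtain C0 where C0: "C0 \<ge> 0" "\<And>x. x \<ge> 0 \<Longrightarrow> norm (weber a dir0 (of_real x)) \<le> C0"
    "\<And>x. x \<ge> 0 \<Longrightarrow> norm (weber' a dir0 (of_real x)) \<le> C0 * (1 + x)" by (rule weber_real_bound[OF r(1)]) blast
  obtain C3 where C3: "C3 \<ge> 0" "\<And>x. x \<ge> 0 \<Longrightarrow> norm (weber a dir3 (of_real x)) \<le> C3"
    "\<And>x. x \<ge> 0 \<Longrightarrow> norm (weber' a dir3 (of_real x)) \<le> C3 * (1 + x)" by (rule weber_real_bound[OF r(2)]) blast
  show ?thesis
  proof (rule that[of "\<lambda>x. Re (h (of_real x))" "\<lambda>x. Re (h' (of_real x))" "norm c0 * C0 + norm c3 * C3"])
    show "((\<lambda>x. Re (h (of_real x))) has_field_derivative Re (h' (of_real x))) (at x)" for x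
      by (rule Re_deriv[OF h(1)])
    show "((\<lambda>x. Re (h' (of_real x))) has_field_derivative (a - x\<^sup>2 / 4) * Re (h (of_real x))) (at x)" for x
    proof -
      have "Re ((of_real a - (of_real x)\<^sup>2 / 4) * h (of_real x)) = Re (of_real (a - x\<^sup>2 / 4) * h (of_real x))" by simp
      also have "\<dots> = (a - x\<^sup>2 / 4) * Re (h (of_real x))" by (rule Re_of_real_mult)
      finally show ?thesis using Re_deriv[OF h(2), of x] by (simp only:)
    qed
    fix x :: real assume x: "x \<ge> 0"
    have "\<bar>Re (h (of_real x))\<bar> \<le> norm (c0 * weber a dir0 x) + norm (c3 * weber a dir3 x)"
      unfolding h_def by (rule order.trans[OF abs_Re_le_cmod norm_triangle_ineq])
    also have "\<dots> \<le> norm c0 * C0 + norm c3 * C3"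
      unfolding norm_mult using C0(2)[OF x] C3(2)[OF x] by (intro add_mono mult_left_mono) auto
    finally show "\<bar>Re (h (of_real x))\<bar> \<le> norm c0 * C0 + norm c3 * C3" .
    have "\<bar>Re (h' (of_real x))\<bar> \<le> norm (c0 * weber' a dir0 x) + norm (c3 * weber' a dir3 x)"
      unfolding h'_def by (rule order.trans[OF abs_Re_le_cmod norm_triangle_ineq])
    also have "\<dots> \<le> norm c0 * (C0 * (1 + x)) + norm c3 * (C3 * (1 + x))"
      unfolding norm_mult using C0(3)[OF x] C3(3)[OF x] by (intro add_mono mult_left_mono) auto
    finally show "\<bar>Re (h' (of_real x))\<bar> \<le> (norm c0 * C0 + norm c3 * C3) * (1 + x)" by (simp add: algebra_simps)
  qed (use init in auto)
qed

text \<open>The fundamental pair comes from the existence lemma with initial values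
  \<open>(1, 0)\<close> and \<open>(0, 1)\<close>.\<close>

lemma real_weber_unique:
  fixes a :: real
  assumes f: "\<And>x. (f has_field_derivative f' x) (at x)" "\<And>x. (f' has_field_derivative (a - x\<^sup>2 / 4) * f x) (at x)"
    and g: "\<And>x. (g has_field_derivative g' x) (at x)" "\<And>x. (g' has_field_derivative (a - x\<^sup>2 / 4) * g x) (at x)"
    and "f 0 = g 0" "f' 0 = g' 0"
  shows "f = g"
proof -
  obtain p p' M where p: "\<And>x. (p has_field_derivative p' x) (at x)"
      "\<And>x. (p' has_field_derivative (a - x\<^sup>2 / 4) * p x) (at x)" "p 0 = 1" "p' 0 = 0"
    by (rule real_weber_exists[of a 1 0]) blast
  obtain q q' N where q: "\<And>x. (q has_field_derivative q' x) (at x)"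
      "\<And>x. (q' has_field_derivative (a - x\<^sup>2 / 4) * q x) (at x)" "q 0 = 0" "q' 0 = 1"
    by (rule real_weber_exists[of a 0 1]) blast
  show ?thesis
    by (rule linear_ode_unique[OF f g p(1,2) q(1,2)]) (use assms p q in auto)
qed

lemma W_ode:
  obtains w' where "\<And>x. (W a has_field_derivative w' x) (at x)"
    "\<And>x. (w' has_field_derivative (a - x\<^sup>2 / 4) * W a x) (at x)"
proof -
  let ?P = "\<lambda>f. \<exists>f'. (\<forall>x. (f has_real_derivative f' x) (at x) \<and>
      (f' has_real_derivative ((a - x^2/4) * f x)) (at x)) \<and> f 0 = W0 a \<and> f' 0 = W0' a"
  obtain f f' M where f: "\<And>x. (f has_field_derivative f' x) (at x)"
      "\<And>x. (f' has_field_derivative (a - x\<^sup>2 / 4) * f x) (at x)" "f 0 = W0 a" "f' 0 = W0' a"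
    by (rule real_weber_exists[of a "W0 a" "W0' a"]) blast
  have "W a = f"
    unfolding W_def
  proof (rule the_equality)
    show "?P f" using f by (intro exI[of _ f']) simp
    fix g assume "?P g"
    then obtain g' where g: "\<And>x. (g has_field_derivative g' x) (at x)"
      "\<And>x. (g' has_field_derivative (a - x\<^sup>2 / 4) * g x) (at x)" "g 0 = W0 a" "g' 0 = W0' a" by blast
    show "g = f"
      by (rule real_weber_unique[OF g(1,2) f(1,2)]) (simp_all add: f(3,4) g(3,4))
  qed
  then show ?thesis using that[of f'] f(1,2) by simp
qed

text \<open>The reflected function solves the same equation, which is even. Its bound for
  \<open>x \<ge> 0\<close> comes from a solution built afresh with the reflected initial values,
  which uniqueness identifies with it; in this way both ends of the real line are reached.\<close>

lemma W_reflect_bound: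
  assumes s: "s = 1 \<or> s = (-1::real)"
  obtains w' M where "\<And>x. ((\<lambda>t. W a (s * t)) has_field_derivative w' x) (at x)"
    "\<And>x. (w' has_field_derivative (a - x\<^sup>2 / 4) * W a (s * x)) (at x)"
    "w' 0 = s * deriv (W a) 0"
    "\<And>x. x \<ge> 0 \<Longrightarrow> \<bar>W a (s * x)\<bar> \<le> M" "\<And>x. x \<ge> 0 \<Longrightarrow> \<bar>w' x\<bar> \<le> M * (1 + x)"
proof -
  obtain w where w: "\<And>x. (W a has_field_derivative w x) (at x)"
    "\<And>x. (w has_field_derivative (a - x\<^sup>2 / 4) * W a x) (at x)" by (rule W_ode) blast
  have d0: "deriv (W a) 0 = w 0" using w(1) by (rule DERIV_imp_deriv)
  have scale: "((\<lambda>t. s * t) has_field_derivative s) (at x)" for x by (auto intro!: derivative_eq_intros)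
  have sw: "((\<lambda>t. W a (s * t)) has_field_derivative s * w (s * x)) (at x)"
    "((\<lambda>t. s * w (s * t)) has_field_derivative (a - x\<^sup>2 / 4) * W a (s * x)) (at x)" for x
  proof -
    show "((\<lambda>t. W a (s * t)) has_field_derivative s * w (s * x)) (at x)"
      using DERIV_chain'[OF scale w(1), of x] by (simp only: mult.commute[of s "w (s * x)"])
    show "((\<lambda>t. s * w (s * t)) has_field_derivative (a - x\<^sup>2 / 4) * W a (s * x)) (at x)"
      using DERIV_cmult[OF DERIV_chain'[OF scale w(2)], of s] s by auto
  qed
  obtain f f' M where f: "\<And>x. (f has_field_derivative f' x) (at x)"
      "\<And>x. (f' has_field_derivative (a - x\<^sup>2 / 4) * f x) (at x)" "f 0 = W a 0" "f' 0 = s * w 0"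
      "\<And>x. x \<ge> 0 \<Longrightarrow> \<bar>f x\<bar> \<le> M" "\<And>x. x \<ge> 0 \<Longrightarrow> \<bar>f' x\<bar> \<le> M * (1 + x)"
    by (rule real_weber_exists[of a "W a 0" "s * w 0"]) blast
  have eq: "(\<lambda>t. W a (s * t)) = f"
    by (rule real_weber_unique[OF sw f(1,2)]) (simp_all add: f(3,4))
  show ?thesis
  proof (rule that[of f' M])
    show "((\<lambda>t. W a (s * t)) has_field_derivative f' x) (at x)" for x unfolding eq by (rule f)
    show "(f' has_field_derivative (a - x\<^sup>2 / 4) * W a (s * x)) (at x)" for x
      using f(2)[of x] fun_cong[OF eq, of x] by simp
    show "\<bar>W a (s * x)\<bar> \<le> M" if "x \<ge> 0" for x using f(5)[OF that] fun_cong[OF eq, of x] by simp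
  qed (simp_all add: f d0)
qed

section \<open>Laplace transforms of Weber functions\<close>

text \<open>With a primitive \<open>g\<close> of \<open>f\<close>, the contour integral is
  \<open>g z - g 0\<close>, and the ray integral times \<open>d\<close> is the limit of
  \<open>g (r * d) - g 0\<close>. So \<open>int_from_inf d f\<close> is the primitive that vanishes
  at infinity along \<open>d\<close>.\<close>

lemma int_from_inf_primitive:
  assumes "f holomorphic_on UNIV"
  shows "(int_from_inf d f has_field_derivative f z) (at z)"
    and "(\<lambda>r. f (of_real r * d)) absolutely_integrable_on {0..} \<Longrightarrow>
      ((\<lambda>r. int_from_inf d f (of_real r * d)) \<longlongrightarrow> 0) at_top"
proof -
  obtain g where g: "\<And>z. (g has_field_derivative f z) (at z)"
    using holomorphic_convex_primitive'[OF convex_UNIV open_UNIV assms] by auto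
  have I: "int_from_inf d f z = g z - g 0 - d * integral {0..} (\<lambda>r. f (of_real r * d))" for z
    using contour_integral_primitive[of UNIV g f "linepath 0 z"] g
    by (simp add: int_from_inf_def contour_integral_unique)
  show "(int_from_inf d f has_field_derivative f z) (at z)"
    unfolding I[abs_def] by (auto intro!: derivative_eq_intros g)
  assume ai: "(\<lambda>r. f (of_real r * d)) absolutely_integrable_on {0..}"
  have vd: "((\<lambda>r. g (of_real r * d)) has_vector_derivative d * f (of_real r * d)) (at r)" for r
  proof -
    have "((\<lambda>w. w * d) has_field_derivative d) (at (of_real r))"
      by (auto intro!: derivative_eq_intros)
    from DERIV_chain2[OF g this]
    have "((\<lambda>w. g (w * d)) has_field_derivative d * f (of_real r * d)) (at (of_real r))"
      by (simp only: mult.commute[of d])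
    then show ?thesis by (rule has_vector_derivative_real_field)
  qed
  have "((\<lambda>r. g (of_real r * d)) \<longlongrightarrow> g (of_real 0 * d) + integral {0..} (\<lambda>r. d * f (of_real r * d))) at_top"
  proof (rule tendsto_primitive_at_top)
    show "(\<lambda>r. d * f (of_real r * d)) absolutely_integrable_on {0..}"
      using ai by (rule set_integrable_mult_right)
    show "continuous_on {0..} (\<lambda>r. g (of_real r * d))"
      using vd by (intro continuous_at_imp_continuous_on ballI has_vector_derivative_continuous)
  qed (rule vd)
  then show "((\<lambda>r. int_from_inf d f (of_real r * d)) \<longlongrightarrow> 0) at_top"
    unfolding I by (auto intro!: tendsto_eq_intros simp: integral_mult_right)
qed

lemma weber_ray_absolutely_integrable:
  assumes "recessive_direction d"
  shows "(\<lambda>r. (of_real r * d) ^ R * weber a d (of_real r * d)) absolutely_integrable_on {0..}"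
proof -
  obtain C where C: "C \<ge> 0" "\<And>r. r \<ge> 0 \<Longrightarrow> norm (weber a d (of_real r * d)) \<le> C * exp (- r\<^sup>2 / 4)"
    by (rule weber_ray_bound[OF assms]) blast
  show ?thesis
  proof (rule absolutely_integrable_exp_bound)
    have "continuous_on UNIV (weber a d)"
      by (intro continuous_at_imp_continuous_on ballI DERIV_isCont[OF weber_ode(1)[OF assms]])
    then have "continuous_on {0..} (\<lambda>r. weber a d (of_real r * d))"
      by (rule continuous_on_compose2) (auto intro!: continuous_intros)
    then show "continuous_on {0..} (\<lambda>r. (of_real r * d) ^ R * weber a d (of_real r * d))"
      by (intro continuous_on_mult continuous_on_power) (auto intro!: continuous_intros)
    fix r :: real assume r: "r \<ge> 0"
    have "norm ((of_real r * d) ^ R * weber a d (of_real r * d)) = r ^ R * norm (weber a d (of_real r * d))"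
      using r recessive_directionD(2)[OF assms] by (simp add: norm_mult norm_power)
    also have "\<dots> \<le> r ^ R * (C * exp (- r\<^sup>2 / 4))"
      using r by (intro mult_left_mono C(2)) auto
    \<comment> \<open>The crude bound \<open>r \<le> exp r\<close> turns the power into
      \<open>exp (R * r)\<close>; completing the square against the Gaussian then leaves a constant
      times \<open>exp (- r)\<close>.\<close>
    also have "\<dots> \<le> exp r ^ R * (C * exp (- r\<^sup>2 / 4))"
      using r C(1) by (intro mult_right_mono power_mono order.trans[OF _ exp_ge_add_one_self]) auto
    also have "\<dots> = C * (exp (real R * r) * exp (- r\<^sup>2 / 4))"
      by (simp add: exp_of_nat_mult)
    also have "\<dots> = C * exp (real R * r - r\<^sup>2 / 4)"
      by (simp flip: exp_add)
    also have "\<dots> \<le> C * exp ((real R + 1)\<^sup>2 - r)"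
    proof -
      have "real R * r - r\<^sup>2 / 4 \<le> (real R + 1)\<^sup>2 - r"
        using zero_le_power2[of "r / 2 - (real R + 1)"] by (simp add: power2_eq_square field_simps)
      then show ?thesis using C(1) by (intro mult_left_mono) auto
    qed
    finally show "norm ((of_real r * d) ^ R * weber a d (of_real r * d)) \<le> (C * exp ((real R + 1)\<^sup>2)) * exp (- 1 * r)"
      by (simp add: exp_diff exp_minus field_simps)
  qed simp
qed

text \<open>The constant in Green's identity is fixed by letting \<open>z\<close> tend to
  infinity along the ray on which \<open>weber a d\<close> decays.\<close>

lemma green_identity:
  fixes p q :: complex
  assumes d: "recessive_direction d"
    and y: "\<And>z. Re z > 0 \<Longrightarrow> (y has_field_derivative y' z) (at z)"
      "\<And>z. Re z > 0 \<Longrightarrow> (y' has_field_derivative p + q * z - (z\<^sup>2 / 4 - of_real a) * y z) (at z)"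
    and bd: "\<And>r. r \<ge> 1 \<Longrightarrow> norm (y (of_real r * d)) \<le> M" "\<And>r. r \<ge> 1 \<Longrightarrow> norm (y' (of_real r * d)) \<le> M"
    and z: "Re z > 0"
  shows "y z * weber' a d z - y' z * weber a d z =
    - (p * int_from_inf d (\<lambda>t. t ^ 0 * weber a d t) z + q * int_from_inf d (\<lambda>t. t ^ 1 * weber a d t) z)"
proof -
  have hol: "(\<lambda>t. t ^ R * weber a d t) holomorphic_on UNIV" for R
    using weber_ode(1)[OF d] by (intro holomorphic_intros) (auto simp: holomorphic_on_open)
  note I = int_from_inf_primitive[OF hol]
  \<comment> \<open>The derivative of \<open>y * weber' - y' * weber\<close> is
    \<open>- (p + q * z) * weber\<close>. \<open>J\<close> is the compensating primitive that
    vanishes at infinity along \<open>d\<close>, so \<open>H\<close> is constant on the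
    half-plane.\<close>
  define J where "J = (\<lambda>z. p * int_from_inf d (\<lambda>t. t ^ 0 * weber a d t) z + q * int_from_inf d (\<lambda>t. t ^ 1 * weber a d t) z)"
  define H where "H = (\<lambda>z. y z * weber' a d z - y' z * weber a d z + J z)"
  have J: "(J has_field_derivative (p + q * z) * weber a d z) (at z)" for z
    unfolding J_def by (rule derivative_eq_intros I refl)+ (simp add: algebra_simps)
  have J0: "((\<lambda>r. J (of_real r * d)) \<longlongrightarrow> 0) at_top"
    using tendsto_add[OF tendsto_mult_left[OF I(2)[OF weber_ray_absolutely_integrable[OF d]], of p]
        tendsto_mult_left[OF I(2)[OF weber_ray_absolutely_integrable[OF d]], of q]]
    unfolding J_def by (simp only: mult_zero_right add_0)
  have "\<exists>c. \<forall>z\<in>{z. Re z > 0}. H z = c"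
  proof (rule has_field_derivative_zero_constant)
    show "convex {z. Re z > 0}" by (rule convex_halfspace_Re_gt)
    fix z :: complex assume "z \<in> {z. Re z > 0}"
    then have z: "Re z > 0" by simp
    show "(H has_field_derivative 0) (at z within {z. Re z > 0})"
      unfolding H_def
      by (rule has_field_derivative_at_within)
         (auto intro!: derivative_eq_intros y[OF z] weber_ode[OF d] J simp: algebra_simps)
  qed
  then obtain c where c: "\<And>z. Re z > 0 \<Longrightarrow> H z = c" by blast
  obtain C where C: "C \<ge> 0" "\<And>r. r \<ge> 0 \<Longrightarrow> norm (weber a d (of_real r * d)) \<le> C * exp (- r\<^sup>2 / 4)"
    "\<And>r. r \<ge> 0 \<Longrightarrow> norm (weber' a d (of_real r * d)) \<le> C * (1 + r) * exp (- r\<^sup>2 / 4)"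
    by (rule weber_ray_bound[OF d]) blast
  have "((\<lambda>r. y (of_real r * d) * weber' a d (of_real r * d) - y' (of_real r * d) * weber a d (of_real r * d)) \<longlongrightarrow> 0) at_top"
  proof (rule Lim_null_comparison)
    show "\<forall>\<^sub>F r in at_top. norm (y (of_real r * d) * weber' a d (of_real r * d) - y' (of_real r * d) * weber a d (of_real r * d))
       \<le> M * (C * (1 + r) * exp (- r\<^sup>2 / 4)) + M * (C * exp (- r\<^sup>2 / 4))"
      using eventually_ge_at_top[of 1]
    proof eventually_elim
      case (elim r)
      have "M \<ge> 0" by (rule order.trans[OF norm_ge_zero bd(1)[OF order.refl]])
      moreover have "r \<ge> 0" using elim by simp
      ultimately show ?case
        using mult_mono[OF bd(1)[OF elim] C(3)[of r]] mult_mono[OF bd(2)[OF elim] C(2)[of r]]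
        by (intro order.trans[OF norm_triangle_ineq4] add_mono) (simp_all add: norm_mult)
    qed
    show "((\<lambda>r. M * (C * (1 + r) * exp (- r\<^sup>2 / 4)) + M * (C * exp (- r\<^sup>2 / 4))) \<longlongrightarrow> 0) at_top"
    proof -
      have "((\<lambda>r::real. (1 + r) * exp (- r\<^sup>2 / 4)) \<longlongrightarrow> 0) at_top" "((\<lambda>r::real. exp (- r\<^sup>2 / 4)) \<longlongrightarrow> 0) at_top"
        by real_asymp+
      from tendsto_add[OF tendsto_mult_left[OF this(1), of "M * C"] tendsto_mult_left[OF this(2), of "M * C"]]
      show ?thesis by (simp add: mult_ac)
    qed
  qed
  from tendsto_add[OF this J0] have "((\<lambda>r. H (of_real r * d)) \<longlongrightarrow> 0) at_top" by (simp add: H_def)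
  moreover have "((\<lambda>r. H (of_real r * d)) \<longlongrightarrow> c) at_top"
    using recessive_directionD(1)[OF d]
    by (intro tendsto_eventually eventually_mono[OF eventually_gt_at_top[of 0]] c) auto
  ultimately have "c = 0" by (intro tendsto_unique[of at_top _ c 0]) auto
  with c[OF z] show ?thesis by (simp add: H_def J_def add_eq_0_iff)
qed

text \<open>Two integrations by parts in one: \<open>F\<close> is chosen so that the terms in
  \<open>w'\<close> cancel on differentiation, leaving
  \<open>exp (- z * t) * (a - z^2 - t^2 / 4) * w t\<close>. The boundary value \<open>F 0\<close> is
  the right-hand side. The factor \<open>t^2\<close> is written as two factors \<open>- t\<close> so
  that its transform is literally the second derivative of \<open>laplace \<phi>\<close>.\<close>

lemma laplace_weber_ode:
  fixes w w' :: "real \<Rightarrow> real"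
  assumes w: "\<And>x. (w has_field_derivative w' x) (at x)" "\<And>x. (w' has_field_derivative (a - x\<^sup>2 / 4) * w x) (at x)"
    and bd: "\<And>x. x \<ge> 0 \<Longrightarrow> \<bar>w x\<bar> \<le> M" "\<And>x. x \<ge> 0 \<Longrightarrow> \<bar>w' x\<bar> \<le> M * (1 + x)"
  defines "\<phi> \<equiv> \<lambda>t. complex_of_real (w t)"
  shows "laplace_integrable 0 \<phi>"
    and "Re z > 0 \<Longrightarrow> (z\<^sup>2 - of_real a) * laplace \<phi> z + laplace (\<lambda>t. - of_real t * (- of_real t * \<phi> t)) z / 4
       = of_real (w' 0) + z * of_real (w 0)"
proof -
  have cont: "continuous_on S w" "continuous_on S w'" for S
    by (intro continuous_at_imp_continuous_on ballI DERIV_isCont[OF w(1)] DERIV_isCont[OF w(2)])+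
  show L: "laplace_integrable 0 \<phi>"
    unfolding laplace_integrable_def
  proof (intro allI impI)
    fix z :: complex assume z: "Re z > 0"
    show "(\<lambda>t. exp (- z * of_real t) * \<phi> t) absolutely_integrable_on {0..}"
    proof (rule absolutely_integrable_exp_bound[OF _ _ z])
      show "continuous_on {0..} (\<lambda>t. exp (- z * of_real t) * \<phi> t)"
        unfolding \<phi>_def by (intro continuous_intros cont)
      show "norm (exp (- z * of_real t) * \<phi> t) \<le> M * exp (- Re z * t)" if "t \<ge> 0" for t
        using bd(1)[OF that] by (simp add: norm_mult \<phi>_def mult.commute)
    qed
  qed
  assume z: "Re z > 0"
  define F where "F = (\<lambda>t. exp (- z * of_real t) * (of_real (w' t) + z * of_real (w t)))"
  define f where "f = (\<lambda>t. (of_real a - z\<^sup>2) * (exp (- z * of_real t) * \<phi> t)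
     - exp (- z * of_real t) * (- of_real t * (- of_real t * \<phi> t)) / 4)"
  note i1 = laplace_integrableD[OF L z]
    and i2 = laplace_integrableD[OF laplace_integrable_mult_ident[OF laplace_integrable_mult_ident[OF L]] z]
  have "(f has_integral (of_real a - z\<^sup>2) * laplace \<phi> z - laplace (\<lambda>t. - of_real t * (- of_real t * \<phi> t)) z / 4) {0..}"
    unfolding f_def laplace_def using i1 i2
    by (intro has_integral_diff has_integral_mult_right has_integral_divide integrable_integral)
       (auto simp: absolutely_integrable_on_def)
  then have int: "integral {0..} f = (of_real a - z\<^sup>2) * laplace \<phi> z - laplace (\<lambda>t. - of_real t * (- of_real t * \<phi> t)) z / 4"
    by (rule integral_unique)
  have vd: "(F has_vector_derivative f t) (at t)" for t
  proof -
    have e: "((\<lambda>t. exp (- z * of_real t)) has_vector_derivative - z * exp (- z * of_real t)) (at t)"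
      by (rule has_vector_derivative_real_field) (auto intro!: derivative_eq_intros)
    have ww: "((\<lambda>t. complex_of_real (w t)) has_vector_derivative of_real (w' t)) (at t)"
       "((\<lambda>t. complex_of_real (w' t)) has_vector_derivative of_real ((a - t\<^sup>2 / 4) * w t)) (at t)"
      by (rule has_vector_derivative_of_real w)+
    show ?thesis unfolding F_def f_def \<phi>_def
      by (rule has_vector_derivative_eq_rhs
        [OF has_vector_derivative_mult[OF e has_vector_derivative_add[OF ww(2) has_vector_derivative_mult_right[OF ww(1)]]]])
        (simp add: algebra_simps power2_eq_square)
  qed
  have "(F \<longlongrightarrow> F 0 + integral {0..} f) at_top"
  proof (rule tendsto_primitive_at_top)
    show "f absolutely_integrable_on {0..}" unfolding f_def
      by (intro set_integral_diff set_integrable_mult_right set_integrable_divide i1 i2)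
    show "continuous_on {0..} F" unfolding F_def by (intro continuous_intros cont)
  qed (rule vd)
  moreover have "(F \<longlongrightarrow> 0) at_top"
  proof (rule Lim_null_comparison)
    show "\<forall>\<^sub>F t in at_top. norm (F t) \<le> exp (- Re z * t) * (M * (1 + t) + norm z * M)"
      using eventually_ge_at_top[of 0]
    proof eventually_elim
      case (elim t)
      have "norm (of_real (w' t) + z * of_real (w t)) \<le> M * (1 + t) + norm z * M"
        using bd(2)[OF elim] mult_left_mono[OF bd(1)[OF elim] norm_ge_zero[of z]]
        by (intro order.trans[OF norm_triangle_ineq] add_mono) (simp_all add: norm_mult)
      then show ?case by (simp add: F_def norm_mult)
    qed
    have "((\<lambda>t. exp (- Re z * t) * (1 + t)) \<longlongrightarrow> 0) at_top" "((\<lambda>t. exp (- Re z * t)) \<longlongrightarrow> 0) at_top"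
      using z by real_asymp+
    from tendsto_add[OF tendsto_mult_left[OF this(1), of M] tendsto_mult_left[OF this(2), of "norm z * M"]]
    show "((\<lambda>t. exp (- Re z * t) * (M * (1 + t) + norm z * M)) \<longlongrightarrow> 0) at_top"
      by (simp add: algebra_simps)
  qed
  ultimately have "F 0 + integral {0..} f = 0"
    by (intro tendsto_unique[of at_top F]) auto
  then show "(z\<^sup>2 - of_real a) * laplace \<phi> z + laplace (\<lambda>t. - of_real t * (- of_real t * \<phi> t)) z / 4
       = of_real (w' 0) + z * of_real (w 0)"
    unfolding int by (simp add: F_def algebra_simps)
qed

section \<open>Representation by Nield-Kuznetsov functions and analytic continuation\<close>

lemma NK_holomorphic: "NK R a holomorphic_on UNIV"
proof -
  note r = recessive_direction_dir
  have hol: "weber a d holomorphic_on UNIV" if "recessive_direction d" for d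
    using weber_ode(1)[OF that] by (auto simp: holomorphic_on_open)
  have I: "int_from_inf e (\<lambda>t. t ^ R * weber a d t) holomorphic_on UNIV" if "recessive_direction d" for d e
  proof -
    have "(\<lambda>t. t ^ R * weber a d t) holomorphic_on UNIV" by (intro holomorphic_intros hol that)
    from int_from_inf_primitive(1)[OF this] show ?thesis by (auto simp: holomorphic_on_open)
  qed
  show ?thesis
    unfolding NK_def[abs_def] Wj_eq_weber by (intro holomorphic_intros hol I r)
qed

text \<open>The solution \<open>w\<close> is arbitrary, so that one statement covers both
  \<open>W a t\<close> and \<open>W a (- t)\<close>.\<close>

lemma laplace_weber_eq_NK:
  fixes w w' :: "real \<Rightarrow> real"
  assumes w: "\<And>x. (w has_field_derivative w' x) (at x)" "\<And>x. (w' has_field_derivative (a - x\<^sup>2 / 4) * w x) (at x)"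
    and bd: "\<And>x. x \<ge> 0 \<Longrightarrow> \<bar>w x\<bar> \<le> M" "\<And>x. x \<ge> 0 \<Longrightarrow> \<bar>w' x\<bar> \<le> M * (1 + x)"
    and z: "Re z > 0"
  shows "laplace (\<lambda>t. of_real (w t)) (z / 2) = of_real (w' 0) * NK 0 a z + of_real (w 0) / 2 * NK 1 a z"
proof -
  note r = recessive_direction_dir
  define \<phi> where "\<phi> = (\<lambda>t. complex_of_real (w t))"
  define \<phi>1 where "\<phi>1 = (\<lambda>t. - of_real t * \<phi> t)"
  have L: "laplace_integrable 0 \<phi>"
    unfolding \<phi>_def by (rule laplace_weber_ode(1)[OF w bd])
  have ode: "(z\<^sup>2 - of_real a) * laplace \<phi> z + laplace (\<lambda>t. - of_real t * \<phi>1 t) z / 4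
       = of_real (w' 0) + z * of_real (w 0)" if "Re z > 0" for z
    unfolding \<phi>1_def \<phi>_def by (rule laplace_weber_ode(2)[OF w bd that])
  have L1: "laplace_integrable 0 \<phi>1" unfolding \<phi>1_def by (rule laplace_integrable_mult_ident[OF L])
  \<comment> \<open>Halving the argument gives the second derivative of \<open>y\<close> the factor
    \<open>1/4\<close> that already stands in \<open>ode\<close>; the forcing term becomes
    \<open>p + q * z\<close>, whence the \<open>1/2\<close> in \<open>q\<close>.\<close>
  define y where "y = (\<lambda>z. laplace \<phi> (z / 2))"
  define y' where "y' = (\<lambda>z. laplace \<phi>1 (z / 2) / 2)"
  define p where "p = complex_of_real (w' 0)"
  define q where "q = complex_of_real (w 0) / 2"
  have half: "((\<lambda>z::complex. z / 2) has_field_derivative 1 / 2) (at z)" for z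
    by (auto intro!: derivative_eq_intros)
  have y: "(y has_field_derivative y' z) (at z)"
    "(y' has_field_derivative p + q * z - (z\<^sup>2 / 4 - of_real a) * y z) (at z)" if "Re z > 0" for z
  proof -
    from that have z2: "Re (z / 2) > 0" by simp
    show "(y has_field_derivative y' z) (at z)"
      unfolding y_def y'_def
      using DERIV_chain2[OF has_field_derivative_laplace[OF L z2] half] by (simp add: \<phi>1_def)
    have "(y' has_field_derivative laplace (\<lambda>t. - of_real t * \<phi>1 t) (z / 2) / 4) (at z)"
      unfolding y'_def
      using DERIV_cdivide[OF DERIV_chain2[OF has_field_derivative_laplace[OF L1 z2] half], of 2] by simp
    also have "laplace (\<lambda>t. - of_real t * \<phi>1 t) (z / 2) / 4 = p + q * z - (z\<^sup>2 / 4 - of_real a) * y z"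
      using ode[OF z2] by (simp add: p_def q_def y_def power_divide algebra_simps)
    finally show "(y' has_field_derivative p + q * z - (z\<^sup>2 / 4 - of_real a) * y z) (at z)" .
  qed
  have green: "y z * weber' a d z - y' z * weber a d z =
    - (p * int_from_inf d (\<lambda>t. t ^ 0 * weber a d t) z + q * int_from_inf d (\<lambda>t. t ^ 1 * weber a d t) z)"
    if d: "recessive_direction d" for d
  proof -
    have d0: "Re d / 2 > 0" using recessive_directionD(1)[OF d] by simp
    \<comment> \<open>The uniform bound on transforms requires a positive abscissa. From
      \<open>r = 1\<close> onwards the points \<open>r * d / 2\<close> have real part at least
      \<open>Re d / 2\<close>.\<close>
    have "\<exists>B. \<forall>r\<ge>1. norm (laplace \<psi> (of_real r * d / 2)) \<le> B" if "laplace_integrable 0 \<psi>" for \<psi>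
    proof (intro exI allI impI)
      fix r :: real assume "r \<ge> 1"
      then have "Re d / 2 \<le> Re (of_real r * d / 2)" using d0 by simp
      then show "norm (laplace \<psi> (of_real r * d / 2))
          \<le> integral {0..} (\<lambda>t. norm (exp (- of_real (Re d / 2) * of_real t) * \<psi> t))"
        by (rule norm_laplace_le[OF that d0])
    qed
    from this[OF L] this[OF L1] obtain B B1 where
      B: "\<And>r. r \<ge> 1 \<Longrightarrow> norm (laplace \<phi> (of_real r * d / 2)) \<le> B"
        "\<And>r. r \<ge> 1 \<Longrightarrow> norm (laplace \<phi>1 (of_real r * d / 2)) \<le> B1" by blast
    show ?thesis
    proof (rule green_identity[OF d y _ _ z])
      fix r :: real assume r: "r \<ge> 1"
      show "norm (y (of_real r * d)) \<le> max B (B1 / 2)" "norm (y' (of_real r * d)) \<le> max B (B1 / 2)"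
        using B(1)[OF r] B(2)[OF r] by (auto simp: y_def y'_def norm_divide)
    qed
  qed
  have e: "exp (\<i> * of_real pi / 4) = dir0" "exp (- \<i> * of_real pi / 4) = dir3" by (simp_all add: dir0_def dir3_def)
  define I where "I = (\<lambda>d. p * int_from_inf d (\<lambda>t. t ^ 0 * weber a d t) z + q * int_from_inf d (\<lambda>t. t ^ 1 * weber a d t) z)"
  define k where "k = \<i> * exp (complex_of_real (pi * a / 2))"
  have G: "I d = y' z * weber a d z - y z * weber' a d z" if "recessive_direction d" for d
    using green[OF that] unfolding I_def by (simp add: algebra_simps)
  have "p * (c * (u * A0 - v * B0)) + q * (c * (u * A1 - v * B1)) = c * (u * (p * A0 + q * A1) - v * (p * B0 + q * B1))"
    for c u v A0 A1 B0 B1 by (simp add: algebra_simps)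
  then have "p * NK 0 a z + q * NK 1 a z = k * (weber a dir3 z * I dir0 - weber a dir0 z * I dir3)"
    unfolding NK_def Wj_eq_weber e I_def k_def .
  \<comment> \<open>On inserting both Green identities the terms with \<open>y'\<close> cancel, and
    \<open>y z\<close> multiplies the normalised Wronskian.\<close>
  also have "\<dots> = y z * (k * (weber' a dir3 z * weber a dir0 z - weber' a dir0 z * weber a dir3 z))"
    unfolding G[OF r(1)] G[OF r(2)] by (simp add: algebra_simps)
  also have "\<dots> = y z"
    unfolding k_def weber_wronskian by simp
  finally show ?thesis by (simp add: y_def p_def q_def \<phi>_def)
qed

text \<open>The sign \<open>s\<close> enters only through the derivative at 0. The right-hand side
  is entire and equals the integral for \<open>Re z > 0\<close>; by the identity theorem it is the
  only such function, so it is the value of the definite description in \<open>LW\<close>.\<close>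

lemma LW_eq_NK:
  assumes s: "s = 1 \<or> s = (-1::real)"
  shows "LW s a lam = of_real (s * deriv (W a) 0) * NK 0 a (2 * lam) + of_real (W a 0) / 2 * NK 1 a (2 * lam)"
proof -
  obtain w' M where w: "\<And>x. ((\<lambda>t. W a (s * t)) has_field_derivative w' x) (at x)"
    "\<And>x. (w' has_field_derivative (a - x\<^sup>2 / 4) * W a (s * x)) (at x)"
    "w' 0 = s * deriv (W a) 0"
    "\<And>x. x \<ge> 0 \<Longrightarrow> \<bar>W a (s * x)\<bar> \<le> M" "\<And>x. x \<ge> 0 \<Longrightarrow> \<bar>w' x\<bar> \<le> M * (1 + x)"
    by (rule W_reflect_bound[OF s]) blast
  note L = laplace_weber_ode(1)[OF w(1,2,4,5)]
  define F where "F = (\<lambda>z. of_real (s * deriv (W a) 0) * NK 0 a (2 * z) + of_real (W a 0) / 2 * NK 1 a (2 * z))"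
  have hol: "F holomorphic_on UNIV"
  proof -
    have "(\<lambda>z. NK R a (2 * z)) holomorphic_on UNIV" for R
      by (rule holomorphic_on_compose_gen[OF _ NK_holomorphic, unfolded o_def]) (auto intro!: holomorphic_intros)
    then show ?thesis unfolding F_def by (intro holomorphic_intros)
  qed
  have F: "((\<lambda>t. exp (- z * of_real t) * of_real (W a (s * t))) has_integral F z) {0..}" if z: "Re z > 0" for z
  proof -
    have "laplace (\<lambda>t. of_real (W a (s * t))) z = F z"
      using laplace_weber_eq_NK[OF w(1,2,4,5), of "2 * z"] z by (simp add: F_def w(3))
    moreover have "(\<lambda>t. exp (- z * of_real t) * of_real (W a (s * t))) integrable_on {0..}"
      using laplace_integrableD[OF L z] by (simp add: absolutely_integrable_on_def)
    ultimately show ?thesis unfolding laplace_def by (simp only: has_integral_iff)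
  qed
  have "LW s a = F"
    unfolding LW_def
  proof (rule the_equality)
    fix G assume "G holomorphic_on UNIV \<and> (\<forall>lam. Re lam > 0 \<longrightarrow>
        ((\<lambda>t::real. exp (- lam * complex_of_real t) * complex_of_real (W a (s * t))) has_integral G lam) {0..})"
    then have G: "G holomorphic_on UNIV" "\<And>z. Re z > 0 \<Longrightarrow>
        ((\<lambda>t::real. exp (- z * complex_of_real t) * complex_of_real (W a (s * t))) has_integral G z) {0..}"
      by auto
    show "G = F"
    proof
      fix z
      show "G z = F z"
      proof (rule analytic_continuation_open[of "{z. Re z > 0}" UNIV G F])
        show "G z = F z" if "z \<in> {z. Re z > 0}" for z
          using that by (intro has_integral_unique[OF G(2) F]) auto
      qed (use G(1) hol in \<open>auto simp: open_halfspace_Re_gt intro!: exI[of _ 1]\<close>)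
    qed
  qed (intro conjI allI impI hol F)
  then show ?thesis by (simp add: F_def)
qed

theorem theorem4p3:
  fixes a :: real and lam :: complex
  shows "LW 1 a lam = complex_of_real (deriv (W a) 0) * NK 0 a (2 * lam)
                      + 1/2 * complex_of_real (W a 0) * NK 1 a (2 * lam)
       \<and> LW (-1) a lam = - complex_of_real (deriv (W a) 0) * NK 0 a (2 * lam)
                      + 1/2 * complex_of_real (W a 0) * NK 1 a (2 * lam)"
  using LW_eq_NK[of 1 a lam] LW_eq_NK[of "-1" a lam] by simp

end
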